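(* Let $p\in(0,\infty)$ and let $W$ be a matrix weight on $\mathbb R^n$ with values in $M_m(\mathbb C)$. For every cube $Q$, let $A_Q$ be a reducing operator of order $p$ for $W$ on $Q$. Then $W\in A_{p,\infty}$ if and only if there exists $u\in(0,\infty)$ such that $$\sup_{Q\subset\mathbb R^n\ \text{cube}}\ \fint_Q\left\|W^{-\frac1p}(x)A_Q\right\|^u\,dx<\infty.$$
   Context: Fix $m,n\in\mathbb N$. $M_m(\mathbb C)$ is the set of complex $m\times m$ matrices and $\|\cdot\|$ is the operator norm induced by the Euclidean norm $|\cdot|$ of $\mathbb C^m$. A cube in $\mathbb R^n$ has edges parallel to the coordinate axes and finite positive edge length (not necessarily open or closed). $\fint_E f:=\frac1{|E|}\int_E f$, $\log_+t:=\max\{0,\log t\}$. A matrix weight is a function $W:\mathbb R^n\to M_m(\mathbb C)$ such that $W(x)$ is nonnegative definite for every $x$, $W(x)$ is invertible for almost every $x$, and all entries of $W$ are locally integrable. Real powers $W^\alpha(x)$ are defined by the spectral theorem. Reducing operator: for a matrix weight $W$ and a bounded measurable set $E$ with $|E|\in(0,\infty)$, a reducing operator of order $p$ for $W$ on $E$ is a positive definite $A_E\in M_m(\mathbb C)$ such that $|A_E\vec z|\sim\left[\fint_E|W^{1/p}(x)\vec z|^p\,dx\right]^{1/p}$ for all $\vec z\in\mathbb C^m$, with positive equivalence constants depending only on $m$ and $p$ (such operators exist). $A_{p,\infty}$: a matrix weight $W$ belongs to $A_{p,\infty}$ if, for every cube $Q$, $\log_+\left(\fint_Q\|W^{1/p}(x)W^{-1/p}(\cdot)\|^p\,dx\right)\in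 L^1(Q)$, and $[W]_{A_{p,\infty}}:=\sup_Q\exp\left(\fint_Q\log\left(\fint_Q\|W^{1/p}(x)W^{-1/p}(y)\|^p\,dx\right)dy\right)<\infty$, with the supremum over all cubes. *)

theory Defs
  imports "HOL-Analysis.Analysis"
begin

definition cinner_vec :: "complex ^ 'm \<Rightarrow> complex ^ 'm \<Rightarrow> complex" where
  "cinner_vec z w = (\<Sum>i\<in>UNIV. z $ i * cnj (w $ i))"

definition conj_transpose :: "complex ^ 'm ^ 'm \<Rightarrow> complex ^ 'm ^ 'm" where
  "conj_transpose A = (\<chi> i j. cnj (A $ j $ i))"

definition unitary_matrix :: "complex ^ 'm ^ 'm \<Rightarrow> bool" where
  "unitary_matrix U \<longleftrightarrow> conj_transpose U ** U = mat 1 \<and> U ** conj_transpose U = mat 1"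

definition real_diag :: "real ^ 'm \<Rightarrow> complex ^ 'm ^ 'm" where
  "real_diag d = (\<chi> i j. if i = j then complex_of_real (d $ i) else 0)"

(* Over the complex numbers these conditions force A to be Hermitian. *)
definition nonneg_definite :: "complex ^ 'm ^ 'm \<Rightarrow> bool" where
  "nonneg_definite A \<longleftrightarrow>
     (\<forall>z. Im (cinner_vec (A *v z) z) = 0 \<and> Re (cinner_vec (A *v z) z) \<ge> 0)"

definition pos_definite :: "complex ^ 'm ^ 'm \<Rightarrow> bool" where
  "pos_definite A \<longleftrightarrow>
     (\<forall>z. z \<noteq> 0 \<longrightarrow> Im (cinner_vec (A *v z) z) = 0 \<and> Re (cinner_vec (A *v z) z) > 0)"

(* Real power of a nonnegative definite matrix by the spectral theorem: if A = U diag(d) U^*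
   with U unitary, then A^a = U diag(d_i^a) U^*, which does not depend on the chosen
   diagonalization.  Since 0 powr a = 0, a zero eigenvalue stays zero for every exponent; for
   negative powers of a matrix weight this matters only on the null set where the weight is
   singular. *)
definition mat_powr :: "complex ^ 'm ^ 'm \<Rightarrow> real \<Rightarrow> complex ^ 'm ^ 'm" where
  "mat_powr A a = (THE B. \<exists>U d. unitary_matrix U \<and>
     A = U ** real_diag d ** conj_transpose U \<and>
     B = U ** real_diag (\<chi> i. d $ i powr a) ** conj_transpose U)"

(* The norm of complex ^ 'm is the Euclidean one. *)
definition op_norm :: "complex ^ 'm ^ 'm \<Rightarrow> real" where
  "op_norm A = onorm (\<lambda>z. A *v z)"

(* Each face of a cube may or may not belong to it, wholly and independently of the others. *)
definition is_cube :: "(real ^ 'n) set \<Rightarrow> bool" where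
  "is_cube Q \<longleftrightarrow> (\<exists>a l I. l > 0 \<and>
     (\<forall>i. {a $ i <..< a $ i + l} \<subseteq> I i \<and> I i \<subseteq> {a $ i .. a $ i + l}) \<and>
     Q = {x. \<forall>i. x $ i \<in> I i})"

definition avg :: "(real ^ 'n) set \<Rightarrow> (real ^ 'n \<Rightarrow> real) \<Rightarrow> real" where
  "avg E f = (LINT x:E|lebesgue. f x) / measure lebesgue E"

definition nn_avg :: "(real ^ 'n) set \<Rightarrow> (real ^ 'n \<Rightarrow> real) \<Rightarrow> ennreal" where
  "nn_avg E f = (\<integral>\<^sup>+x\<in>E. ennreal (f x) \<partial>lebesgue) / emeasure lebesgue E"

definition log_plus :: "real \<Rightarrow> real" where
  "log_plus t = max 0 (ln t)"

definition matrix_weight :: "(real ^ 'n \<Rightarrow> complex ^ 'm ^ 'm) \<Rightarrow> bool" where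
  "matrix_weight W \<longleftrightarrow>
     (\<forall>x. nonneg_definite (W x)) \<and>
     (AE x in lebesgue. invertible (W x)) \<and>
     (\<forall>i j K. compact K \<longrightarrow> (\<lambda>x. W x $ i $ j) absolutely_integrable_on K)"

(* c and C are the equivalence constants.  The average is finite, since
   |W^{1/p}(x) z|^p <= ||W(x)|| |z|^p. *)
definition reducing_operator ::
  "real \<Rightarrow> real \<Rightarrow> real \<Rightarrow> (real ^ 'n \<Rightarrow> complex ^ 'm ^ 'm) \<Rightarrow> (real ^ 'n) set
     \<Rightarrow> complex ^ 'm ^ 'm \<Rightarrow> bool" where
  "reducing_operator c C p W E A \<longleftrightarrow> pos_definite A \<and>
     (\<forall>z. c * avg E (\<lambda>x. norm (mat_powr (W x) (1 / p) *v z) powr p) powr (1 / p)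
              \<le> norm (A *v z) \<and>
          norm (A *v z)
              \<le> C * avg E (\<lambda>x. norm (mat_powr (W x) (1 / p) *v z) powr p) powr (1 / p))"

(* The average of ||W^{1/p}(x) W^{-1/p}(y)||^p over x in Q.  It is finite for every y, since the
   integrand is at most ||W(x)|| ||W^{-1/p}(y)||^p. *)
definition A_p_infty_inner ::
  "real \<Rightarrow> (real ^ 'n \<Rightarrow> complex ^ 'm ^ 'm) \<Rightarrow> (real ^ 'n) set \<Rightarrow> real ^ 'n \<Rightarrow> real" where
  "A_p_infty_inner p W Q y =
     avg Q (\<lambda>x. op_norm (mat_powr (W x) (1 / p) ** mat_powr (W y) (- (1 / p))) powr p)"

(* Used only when the positive part of the logarithm is integrable on every cube.  The negative
   part always is: the inner average is bounded below by c_Q / ||W(y)|| with c_Q > 0 for almost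
   every y in Q.  So the integral below never takes a default value. *)
definition A_p_infty_const :: "real \<Rightarrow> (real ^ 'n \<Rightarrow> complex ^ 'm ^ 'm) \<Rightarrow> ennreal" where
  "A_p_infty_const p W =
     (SUP Q\<in>{Q. is_cube Q}. ennreal (exp (avg Q (\<lambda>y. ln (A_p_infty_inner p W Q y)))))"

definition A_p_infty :: "real \<Rightarrow> (real ^ 'n \<Rightarrow> complex ^ 'm ^ 'm) set" where
  "A_p_infty p = {W. matrix_weight W \<and>
     (\<forall>Q. is_cube Q \<longrightarrow> set_integrable lebesgue Q (\<lambda>y. log_plus (A_p_infty_inner p W Q y))) \<and>
     A_p_infty_const p W < \<infinity>}"

end

theory Submission
  imports Defs
begin

text \<open>
  Up to constants, the inner average in \<open>[W]\<close> is \<open>\<parallel>A\<^sub>Q W\<^sup>-\<^sup>1\<^sup>/\<^sup>p(y)\<parallel>\<^sup>p\<close>, so membership in \<open>A\<^sub>p\<^sub>,\<^sub>\<infinity>\<close> says that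
  \<open>G\<^sub>Q = log\<^sub>+ \<parallel>A\<^sub>Q W\<^sup>-\<^sup>1\<^sup>/\<^sup>p\<parallel>\<close> has bounded averages over \<open>Q\<close>; the negative part of the logarithm costs nothing,
  because \<open>W\<^sup>1\<^sup>/\<^sup>p A\<^sub>Q\<^sup>-\<^sup>1\<close> has bounded \<open>L\<^sup>p\<close> averages. Since \<open>log t \<le> t\<^sup>u / u\<close>, the integral condition
  implies this. Conversely, submultiplicativity of the norm gives \<open>G\<^sub>Q \<le> K + avg\<^sub>R G\<^sub>Q + G\<^sub>R\<close> for all cubes
  \<open>Q\<close>, \<open>R\<close>, which is what a John--Nirenberg argument needs: stopping \<open>G\<^sub>Q\<close> at dyadic subcubes \<open>R\<close> bounds
  \<open>sup\<^sub>Q avg\<^sub>Q exp (u G\<^sub>Q)\<close> by a constant plus \<open>3/4\<close> of itself when \<open>u\<close> is small. Truncating \<open>G\<^sub>Q\<close> makes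
  the supremum finite beforehand.
\<close>

subsection \<open>The spectral theorem and real powers of matrices\<close>

text \<open>The classical John-Nirenberg inequality concerns one function, whereas here the function
  changes with the cube, and operators on different cubes are tied together only through
  \<open>W\<close>. With N = W^{-1/p} and P = W^{1/p}, write A_Q N = (A_Q A_R^{-1}) (A_R N); it
  remains to bound a constant matrix. Since A_Q A_R^{-1} = (A_Q N(x)) (P(x) A_R^{-1}) for almost
  every x, averaging the logarithm over R leaves the average of G_Q over R plus a uniform constant,
  because P A_R^{-1} is normalized in L^p on R by the choice of A_R. On a stopping cube the average
  of G_Q is at most 2^n times the stopping height, so replacing G_Q by G_R costs a fixed factor
  after exponentiation. A small u makes this factor at most 3/2, and the height makes the stopping
  cubes fill at most half of Q; 3/4 is the product. A second obstacle is measurability, since powers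
  of \<open>W\<close> are given by a definite description. Norms of P z are handled through the
  reducing inequality, and norms containing N through countably many conditions on P.\<close>

lemma inner_eq_Re_cinner: "inner z w = Re (cinner_vec z w)"
  by (simp add: inner_vec_def cinner_vec_def inner_complex_def)

lemma cinner_cnj: "cnj (cinner_vec z w) = cinner_vec w z"
  by (simp add: cinner_vec_def cnj_sum mult.commute)

lemma cinner_add_left: "cinner_vec (x + y) z = cinner_vec x z + cinner_vec y z"
  and cinner_add_right: "cinner_vec z (x + y) = cinner_vec z x + cinner_vec z y"
  and cinner_diff_left: "cinner_vec (x - y) z = cinner_vec x z - cinner_vec y z"
  and cinner_scale_left: "cinner_vec (c *s x) z = c * cinner_vec x z"
  and cinner_scale_right: "cinner_vec z (c *s x) = cnj c * cinner_vec z x"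
  by (simp_all add: cinner_vec_def sum.distrib sum_subtractf sum_distrib_left algebra_simps)

lemma cinner_sum_left: "cinner_vec (\<Sum>b\<in>B. f b) z = (\<Sum>b\<in>B. cinner_vec (f b) z)"
  unfolding cinner_vec_def sum_component sum_distrib_right by (rule sum.swap)

lemma cinner_self: "cinner_vec z z = of_real ((norm z)\<^sup>2)"
proof -
  have "Im (cinner_vec z z) = 0"
    using cinner_cnj[of z z] by (simp add: complex_eq_iff)
  then show ?thesis
    by (simp add: complex_eq_iff power2_norm_eq_inner inner_eq_Re_cinner)
qed

lemma cinner_conj_transpose: "cinner_vec (A *v z) w = cinner_vec z (conj_transpose A *v w)"
  by (simp add: cinner_vec_def matrix_vector_mult_def conj_transpose_def sum_distrib_left
      sum_distrib_right algebra_simps) (rule sum.swap)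

lemma conj_transpose_mult: "conj_transpose (A ** B) = conj_transpose B ** conj_transpose A"
  by (simp add: conj_transpose_def matrix_matrix_mult_def vec_eq_iff mult.commute)

lemma conj_transpose_conj_transpose [simp]: "conj_transpose (conj_transpose A) = A"
  by (simp add: conj_transpose_def vec_eq_iff)

lemma conj_transpose_real_diag [simp]: "conj_transpose (real_diag d) = real_diag d"
  by (auto simp: conj_transpose_def real_diag_def vec_eq_iff)

lemma cinner_axis: "cinner_vec z (axis i 1) = z $ i"
  by (simp add: cinner_vec_def axis_def if_distrib cong: if_cong)

lemma cinner_eqD:
  assumes "\<And>w. cinner_vec z w = cinner_vec z' w" shows "z = z'"
  by (metis assms cinner_axis vec_eq_iff)

text \<open>Polarization: expanding the form at \<open>z + w\<close> and at
  \<open>z + \<i> *s w\<close> gives the imaginary and the real part of the symmetry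
  relation.\<close>

lemma hermitianI:
  fixes A :: "complex ^ 'm ^ 'm"
  assumes real: "\<And>z. Im (cinner_vec (A *v z) z) = 0"
  shows "conj_transpose A = A"
proof -
  have *: "cinner_vec (A *v z) w = cnj (cinner_vec (A *v w) z)" for z w
  proof -
    have 1: "Im (cinner_vec (A *v (z + w)) (z + w)) = 0"
      and 2: "Im (cinner_vec (A *v (z + \<i> *s w)) (z + \<i> *s w)) = 0"
      using real by blast+
    from 1 have "Im (cinner_vec (A *v z) w) + Im (cinner_vec (A *v w) z) = 0"
      using real[of z] real[of w]
      by (simp add: matrix_vector_right_distrib cinner_add_left cinner_add_right)
    moreover from 2 have "- Re (cinner_vec (A *v z) w) + Re (cinner_vec (A *v w) z) = 0"
      using real[of z] real[of w]
      by (simp add: matrix_vector_right_distrib cinner_add_left cinner_add_right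
          matrix_vector_mult_scaleR vector_scalar_commute cinner_scale_left cinner_scale_right)
    ultimately show ?thesis by (simp add: complex_eq_iff)
  qed
  have "conj_transpose A *v w = A *v w" for w
  proof (rule cinner_eqD)
    fix z
    have "cinner_vec (conj_transpose A *v w) z = cinner_vec w (A *v z)"
      using cinner_conj_transpose[of "conj_transpose A" w z] by simp
    also have "\<dots> = cinner_vec (A *v w) z"
      using * cinner_cnj by metis
    finally show "cinner_vec (conj_transpose A *v w) z = cinner_vec (A *v w) z" .
  qed
  then show ?thesis by (simp add: matrix_eq)
qed

lemma hermitian_cinner:
  assumes "conj_transpose A = A"
  shows "cinner_vec (A *v z) w = cinner_vec z (A *v w)"
  by (simp add: cinner_conj_transpose assms)

text \<open>A maximizer of the Rayleigh quotient on the unit sphere of the orthogonal complement of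
  \<open>B\<close> is an eigenvector. The complement is invariant under \<open>A\<close> because
  \<open>B\<close> consists of eigenvectors, so the residual \<open>v\<close> stays in it and
  \<open>z\<close> may be perturbed along \<open>v\<close>.\<close>

lemma hermitian_eigenvector_orthogonal:
  fixes A :: "complex ^ 'm ^ 'm"
  assumes herm: "conj_transpose A = A"
    and inv: "\<And>b. b \<in> B \<Longrightarrow> \<exists>t. A *v b = of_real t *s b"
    and ne: "\<exists>z. z \<noteq> 0 \<and> (\<forall>b\<in>B. cinner_vec z b = 0)"
  obtains z t where "norm z = 1" "\<forall>b\<in>B. cinner_vec z b = 0" "A *v z = of_real t *s z"
proof -
  define V where "V = {z. \<forall>b\<in>B. cinner_vec z b = 0}"
  define q where "q z = inner (A *v z) z" for z
  have cont_c: "continuous_on UNIV (\<lambda>z. cinner_vec z b)" for b :: "complex ^ 'm"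
    unfolding cinner_vec_def by (intro continuous_intros)
  have cont_q: "continuous_on S q" for S
    unfolding q_def by (intro continuous_intros matrix_vector_mult_linear_continuous_on)
  have "V = (\<Inter>b\<in>B. {z. cinner_vec z b = 0})" by (auto simp: V_def)
  then have "closed V"
    using cont_c by (auto intro!: closed_Collect_eq)
  then have comp: "compact (V \<inter> sphere 0 1)" by (simp add: closed_Int_compact)
  have V_add: "x + y \<in> V" if "x \<in> V" "y \<in> V" for x y
    using that by (auto simp: V_def cinner_add_left)
  have V_scale: "c *s x \<in> V" if "x \<in> V" for x c
    using that by (auto simp: V_def cinner_scale_left)
  have scaleR: "r *\<^sub>R x = of_real r *s x" for r and x :: "complex ^ 'm"
    by (simp add: vec_eq_iff scaleR_conv_of_real[symmetric])
  have V_A: "A *v x \<in> V" if "x \<in> V" for x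
  proof -
    { fix b assume "b \<in> B"
      then obtain t where "A *v b = of_real t *s b" using inv by blast
      then have "cinner_vec (A *v x) b = 0"
        using that \<open>b \<in> B\<close> hermitian_cinner[OF herm, of x b] by (simp add: V_def cinner_scale_right) }
    then show ?thesis by (simp add: V_def)
  qed
  from ne obtain x where x: "x \<noteq> 0" "x \<in> V" by (auto simp: V_def)
  have "(1 / norm x) *\<^sub>R x \<in> V" "norm ((1 / norm x) *\<^sub>R x) = 1"
    using x V_scale[of x "of_real (1 / norm x)"] by (simp_all only: scaleR) (simp add: scaleR[symmetric] del: of_real_divide)
  then have "V \<inter> sphere 0 1 \<noteq> {}" by auto
  from continuous_attains_sup[OF comp this cont_q]
  obtain z where z: "z \<in> V" "norm z = 1" and max: "\<And>w. w \<in> V \<Longrightarrow> norm w = 1 \<Longrightarrow> q w \<le> q z"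
    by auto
  define t where "t = q z"
  define v where "v = t *\<^sub>R z - A *v z"
  have v_alt: "v = t *\<^sub>R z + (- 1) *s (A *v z)" by (simp add: v_def)
  have vV: "v \<in> V"
    unfolding v_alt scaleR by (intro V_add V_scale V_A z)
  \<comment> \<open>\<open>h\<close> is nonnegative on \<open>V\<close> and vanishes at the
    maximizer \<open>z\<close>, so its first-order term along \<open>v\<close>, which is
    \<open>2 * s * inner v v\<close>, has to vanish.\<close>
  define h where "h w = t * inner w w - q w" for w
  have h_nonneg: "0 \<le> h w" if "w \<in> V" for w
  proof (cases "w = 0")
    case False
    let ?w = "(1 / norm w) *\<^sub>R w"
    have "?w \<in> V" using that V_scale by (simp only: scaleR)
    then have "q ?w \<le> t"
      unfolding t_def using False by (intro max) auto
    moreover have "q ?w = q w / (norm w)\<^sup>2"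
      by (simp only: q_def linear_scale[OF matrix_vector_mul_linear] inner_scaleR_left inner_scaleR_right)
        (simp add: power2_eq_square)
    ultimately show ?thesis
      using False by (simp add: h_def power2_norm_eq_inner divide_le_eq)
  qed (simp add: h_def q_def)
  have sym: "inner (A *v x) y = inner (A *v y) x" for x y
    using hermitian_cinner[OF herm, of x y] cinner_cnj[of x "A *v y"]
    by (simp add: inner_eq_Re_cinner complex_eq_iff)
  have expand: "h (z + s *\<^sub>R v) = s\<^sup>2 * h v + 2 * s * inner v v" for s
  proof -
    have "h (z + s *\<^sub>R v) = h z + s\<^sup>2 * h v + 2 * s * (t * inner z v - inner (A *v z) v)"
      using sym[of z v]
      by (simp add: h_def q_def matrix_vector_right_distrib linear_scale[OF matrix_vector_mul_linear]
          inner_add_left inner_add_right power2_eq_square algebra_simps inner_commute)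
    moreover have "h z = 0"
      using z by (simp add: h_def t_def dot_square_norm)
    moreover have "t * inner z v - inner (A *v z) v = inner v v"
      by (subst (3) v_def) (simp add: inner_diff_left)
    ultimately show ?thesis by simp
  qed
  have "v = 0"
  proof (rule ccontr)
    assume "v \<noteq> 0"
    then have pos: "0 < inner v v" by simp
    \<comment> \<open>Negative and so small that the linear term outweighs
      \<open>s\<^sup>2 * h v\<close>; the \<open>+ 1\<close> keeps the denominator positive when
      \<open>h v = 0\<close>.\<close>
    define s where "s = - inner v v / (h v + 1)"
    have hv: "0 \<le> h v" using h_nonneg vV by blast
    have "z + s *\<^sub>R v \<in> V" unfolding scaleR by (intro V_add V_scale z vV)
    from h_nonneg[OF this] have "0 \<le> s\<^sup>2 * h v + 2 * s * inner v v" by (simp add: expand)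
    also have "\<dots> = s * (s * h v + 2 * inner v v)"
      by (simp add: power2_eq_square algebra_simps)
    also have "\<dots> < 0"
    proof (rule mult_neg_pos)
      show "s < 0" using hv pos by (simp add: s_def divide_neg_pos)
      have "h v / (h v + 1) \<le> 1" using hv by simp
      then have "inner v v * (h v / (h v + 1)) \<le> inner v v" using pos by (intro mult_left_le) auto
      moreover have "s * h v = - (inner v v * (h v / (h v + 1)))" by (simp add: s_def)
      ultimately show "0 < s * h v + 2 * inner v v" using pos by linarith
    qed
    finally show False by simp
  qed
  then have "A *v z = of_real t *s z" by (simp add: v_def scaleR)
  then show ?thesis using that z by (auto simp: V_def)
qed

definition orthonormal_eigenset :: "complex ^ 'm ^ 'm \<Rightarrow> (complex ^ 'm) set \<Rightarrow> bool" where
  "orthonormal_eigenset A B \<longleftrightarrow> finite B \<and> (\<forall>b\<in>B. norm b = 1 \<and> (\<exists>t. A *v b = of_real t *s b)) \<and>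
     (\<forall>b\<in>B. \<forall>b'\<in>B. b \<noteq> b' \<longrightarrow> cinner_vec b b' = 0)"

text \<open>Fewer than \<open>CARD('m)\<close> vectors do not span. Removing from a vector outside
  the span its projection leaves a nonzero vector orthogonal to all of them, which is what the
  search for the next eigenvector requires.\<close>

lemma orthonormal_eigenset_exists:
  fixes A :: "complex ^ 'm ^ 'm"
  assumes herm: "conj_transpose A = A" and "k \<le> CARD('m)"
  shows "\<exists>B. orthonormal_eigenset A B \<and> card B = k"
  using \<open>k \<le> CARD('m)\<close>
proof (induction k)
  case 0
  show ?case by (rule exI[of _ "{}"]) (simp add: orthonormal_eigenset_def)
next
  case (Suc k)
  then obtain B where B: "orthonormal_eigenset A B" "card B = k" by auto
  then have fin: "finite B" and on: "\<And>b b'. b \<in> B \<Longrightarrow> b' \<in> B \<Longrightarrow> cinner_vec b b' = (if b = b' then 1 else 0)"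
    by (auto simp: orthonormal_eigenset_def cinner_self)
  have "vec.span B \<noteq> UNIV"
  proof
    assume "vec.span B = UNIV"
    then have "CARD('m) \<le> card B"
      using vec.dim_le_card[of UNIV B] fin vec_dim_card[where 'a = complex and 'n = 'm]
      by (metis order_refl)
    then show False using Suc B by simp
  qed
  then obtain y where y: "y \<notin> vec.span B" by auto
  define z where "z = y - (\<Sum>b\<in>B. cinner_vec y b *s b)"
  have "z \<noteq> 0"
  proof
    assume "z = 0"
    then have "y = (\<Sum>b\<in>B. cinner_vec y b *s b)" by (simp add: z_def)
    also have "\<dots> \<in> vec.span B" by (intro vec.span_sum vec.span_scale vec.span_base)
    finally show False using y by simp
  qed
  moreover have "cinner_vec z b = 0" if "b \<in> B" for b
    using that fin by (simp add: z_def cinner_diff_left cinner_sum_left cinner_scale_left on if_distrib cong: if_cong)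
  ultimately have "\<exists>z. z \<noteq> 0 \<and> (\<forall>b\<in>B. cinner_vec z b = 0)" by blast
  moreover have "\<And>b. b \<in> B \<Longrightarrow> \<exists>t. A *v b = of_real t *s b"
    using B by (auto simp: orthonormal_eigenset_def)
  ultimately obtain w t where w: "norm w = 1" "\<forall>b\<in>B. cinner_vec w b = 0" "A *v w = of_real t *s w"
    using hermitian_eigenvector_orthogonal[OF herm] by metis
  have "w \<notin> B" using w cinner_self[of w] by auto
  moreover have "cinner_vec b w = 0" if "b \<in> B" for b
    using w that cinner_cnj[of w b] by simp
  ultimately show ?case
    using B w by (intro exI[of _ "insert w B"]) (auto simp: orthonormal_eigenset_def)
qed

lemma spectral_theorem:
  fixes A :: "complex ^ 'm ^ 'm"
  assumes herm: "conj_transpose A = A"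
  obtains U d where "unitary_matrix U" "A = U ** real_diag d ** conj_transpose U"
proof -
  obtain B where B: "orthonormal_eigenset A B" "card B = CARD('m)"
    using orthonormal_eigenset_exists[OF herm] by blast
  then have "finite B" by (simp add: orthonormal_eigenset_def)
  then obtain f where f: "bij_betw f (UNIV :: 'm set) B"
    using B(2) finite_same_card_bij[of "UNIV :: 'm set" B] by auto
  have fB: "f i \<in> B" for i using f by (auto simp: bij_betw_def)
  have fi: "f i = f j \<longleftrightarrow> i = j" for i j using f by (auto simp: bij_betw_def inj_def)
  have on: "cinner_vec (f i) (f j) = (if i = j then 1 else 0)" for i j
    using B(1) fB[of i] fB[of j] fi[of i j] by (auto simp: orthonormal_eigenset_def cinner_self)
  have "\<forall>i. \<exists>t. A *v f i = of_real t *s f i"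
    using B(1) fB by (auto simp: orthonormal_eigenset_def)
  then obtain t where t: "\<And>i. A *v f i = of_real (t i) *s f i" by metis
  define U where "U = (\<chi> i j. f j $ i)"
  define d where "d = (\<chi> i. t i)"
  have UU: "conj_transpose U ** U = mat 1"
  proof -
    have "(conj_transpose U ** U) $ i $ j = cinner_vec (f j) (f i)" for i j
      by (simp add: U_def conj_transpose_def matrix_matrix_mult_def cinner_vec_def mult.commute)
    then show ?thesis by (auto simp: vec_eq_iff mat_def on)
  qed
  then have UU': "U ** conj_transpose U = mat 1"
    by (simp add: matrix_left_right_inverse)
  have "A ** U = U ** real_diag d"
  proof -
    have "(A ** U) $ i $ j = (A *v f j) $ i" for i j
      by (simp add: U_def matrix_matrix_mult_def matrix_vector_mult_def)
    moreover have "(U ** real_diag d) $ i $ j = of_real (t j) * f j $ i" for i j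
      by (simp add: U_def d_def matrix_matrix_mult_def real_diag_def if_distrib cong: if_cong)
    ultimately show ?thesis by (simp add: vec_eq_iff t)
  qed
  then have "U ** real_diag d ** conj_transpose U = A"
    by (metis UU' matrix_mul_assoc matrix_mul_rid)
  then show ?thesis using that UU UU' by (metis unitary_matrix_def)
qed

section \<open>Powers of nonnegative definite matrices through diagonalization\<close>

lemma real_diag_mult_left: "(real_diag d ** X) $ i $ j = of_real (d $ i) * X $ i $ j"
  and real_diag_mult_right: "(X ** real_diag d) $ i $ j = of_real (d $ j) * X $ i $ j"
  by (simp_all add: matrix_matrix_mult_def real_diag_def if_distrib[of "\<lambda>x. x * _"]
      if_distrib[of "\<lambda>x. _ * x"] cong: if_cong)

text \<open>The matrix \<open>conj_transpose V ** U\<close> intertwines the two diagonals, so its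
  entry at \<open>i\<close>, \<open>j\<close> can be nonzero only where
  \<open>d $ j = e $ i\<close>, and there \<open>g\<close> takes equal values too. Hence it also
  intertwines the images under \<open>g\<close>. This makes the description in
  \<open>mat_powr\<close> unique.\<close>

lemma diagonalization_map_unique:
  assumes U: "unitary_matrix U" and V: "unitary_matrix V"
    and eq: "U ** real_diag d ** conj_transpose U = V ** real_diag e ** conj_transpose V"
  shows "U ** real_diag (\<chi> i. g (d $ i)) ** conj_transpose U
       = V ** real_diag (\<chi> i. g (e $ i)) ** conj_transpose V"
proof -
  define X where "X = conj_transpose V ** U"
  have U': "conj_transpose U ** U = mat 1" "U ** conj_transpose U = mat 1"
    and V': "conj_transpose V ** V = mat 1" "V ** conj_transpose V = mat 1"
    using U V by (auto simp: unitary_matrix_def)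
  have "X ** real_diag d = conj_transpose V ** (U ** real_diag d ** conj_transpose U) ** U"
    by (metis X_def U'(1) matrix_mul_assoc matrix_mul_rid)
  also have "\<dots> = real_diag e ** X"
    by (metis X_def eq V'(1) matrix_mul_assoc matrix_mul_lid)
  finally have "(X ** real_diag d) $ i $ j = (real_diag e ** X) $ i $ j" for i j by simp
  then have "d $ j = e $ i \<or> X $ i $ j = 0" for i j
    by (auto simp: real_diag_mult_left real_diag_mult_right)
  then have "(X ** real_diag (\<chi> i. g (d $ i))) $ i $ j = (real_diag (\<chi> i. g (e $ i)) ** X) $ i $ j" for i j
    unfolding real_diag_mult_left real_diag_mult_right by (metis mult_zero_right vec_lambda_beta)
  then have "X ** real_diag (\<chi> i. g (d $ i)) = real_diag (\<chi> i. g (e $ i)) ** X"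
    by (simp add: vec_eq_iff)
  then have "V ** (X ** real_diag (\<chi> i. g (d $ i))) ** conj_transpose U
      = V ** (real_diag (\<chi> i. g (e $ i)) ** X) ** conj_transpose U" by simp
  moreover have "V ** X = U" "X ** conj_transpose U = conj_transpose V"
    unfolding X_def by (metis V'(2) matrix_mul_assoc matrix_mul_lid, metis U'(2) matrix_mul_assoc matrix_mul_rid)
  ultimately show ?thesis by (metis matrix_mul_assoc)
qed

lemma mat_powr_eq:
  assumes "unitary_matrix U" "A = U ** real_diag d ** conj_transpose U"
  shows "mat_powr A a = U ** real_diag (\<chi> i. d $ i powr a) ** conj_transpose U"
  unfolding mat_powr_def
proof (rule the_equality)
  fix B assume "\<exists>V e. unitary_matrix V \<and> A = V ** real_diag e ** conj_transpose V \<and>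
      B = V ** real_diag (\<chi> i. e $ i powr a) ** conj_transpose V"
  then show "B = U ** real_diag (\<chi> i. d $ i powr a) ** conj_transpose U"
    using diagonalization_map_unique[where g = "\<lambda>x. x powr a"] assms by metis
qed (use assms in blast)

lemma nonneg_definite_hermitian: "nonneg_definite A \<Longrightarrow> conj_transpose A = A"
  by (rule hermitianI) (simp add: nonneg_definite_def)

lemma pos_definite_hermitian: "pos_definite A \<Longrightarrow> conj_transpose A = A"
  by (rule hermitianI) (metis cinner_self cinner_axis pos_definite_def Im_complex_of_real
      matrix_vector_mult_0_right)

lemma mat_powr_hermitian:
  assumes "nonneg_definite A"
  shows "conj_transpose (mat_powr A a) = mat_powr A a"
proof -
  obtain U d where "unitary_matrix U" "A = U ** real_diag d ** conj_transpose U"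
    using spectral_theorem[OF nonneg_definite_hermitian[OF assms]] .
  from mat_powr_eq[OF this] show ?thesis
    by (simp add: conj_transpose_mult matrix_mul_assoc)
qed

lemma mat_powr_minus_mult:
  fixes A :: "complex ^ 'm ^ 'm"
  assumes "nonneg_definite A" "invertible A"
  shows "mat_powr A (- a) ** mat_powr A a = mat 1"
proof -
  obtain U d where Ud: "unitary_matrix U" "A = U ** real_diag d ** conj_transpose U"
    using spectral_theorem[OF nonneg_definite_hermitian[OF assms(1)]] .
  then have U: "conj_transpose U ** U = mat 1" "U ** conj_transpose U = mat 1"
    by (auto simp: unitary_matrix_def)
  \<comment> \<open>The column \<open>U *v axis i 1\<close> is an eigenvector for
    \<open>d $ i\<close>. Strict positivity matters because \<open>0 powr a = 0\<close> for every
    exponent: a zero eigenvalue would not cancel.\<close>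
  have d: "d $ i > 0" for i
  proof -
    define z where "z = U *v axis i 1"
    have "A *v z = U *v (real_diag d *v axis i 1)"
      unfolding z_def Ud(2) by (metis U(1) matrix_mul_assoc matrix_mul_rid matrix_vector_mul_assoc)
    also have "real_diag d *v axis i 1 = of_real (d $ i) *s axis i 1"
      by (auto simp: vec_eq_iff matrix_vector_mult_def real_diag_def axis_def if_distrib[of "\<lambda>x. _ * x"] cong: if_cong)
    finally have Az: "A *v z = of_real (d $ i) *s z"
      by (simp add: z_def vector_scalar_commute)
    have z0: "z \<noteq> 0"
    proof
      assume "z = 0"
      then have "conj_transpose U *v z = 0" by simp
      then have "axis i (1 :: complex) = 0"
        unfolding z_def by (metis U(1) matrix_vector_mul_assoc matrix_vector_mul_lid)
      then show False by (simp add: axis_eq_0_iff)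
    qed
    have "0 \<le> d $ i * (norm z)\<^sup>2"
      using assms(1) Az by (metis nonneg_definite_def cinner_scale_left cinner_self Re_complex_of_real of_real_mult)
    moreover have "d $ i \<noteq> 0"
    proof
      assume "d $ i = 0"
      then have "A *v z = 0" using Az by simp
      then show False using z0 assms(2)
        by (metis invertible_def matrix_vector_mul_assoc matrix_vector_mul_lid matrix_vector_mult_0_right)
    qed
    ultimately show ?thesis using z0 by (simp add: zero_le_mult_iff less_le)
  qed
  have "real_diag (\<chi> i. d $ i powr (- a)) ** real_diag (\<chi> i. d $ i powr a) = mat 1"
  proof -
    have "(real_diag (\<chi> i. d $ i powr (- a)) ** real_diag (\<chi> i. d $ i powr a)) $ i $ j = mat 1 $ i $ j" for i j
      unfolding real_diag_mult_left using d[of j]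
      by (auto simp add: real_diag_def mat_def powr_minus)
    then show ?thesis by (simp add: vec_eq_iff)
  qed
  then show ?thesis
    unfolding mat_powr_eq[OF Ud] by (metis U matrix_mul_assoc matrix_mul_rid)
qed

section \<open>Estimates for the operator norm\<close>

lemma norm_matrix_vector_le: "norm (A *v z) \<le> op_norm A * norm z"
  for A :: "complex ^ 'm ^ 'm"
  unfolding op_norm_def by (rule onorm) simp

lemma op_norm_nonneg: "0 \<le> op_norm A" for A :: "complex ^ 'm ^ 'm"
  unfolding op_norm_def by (rule onorm_pos_le) simp

lemma op_norm_leI:
  fixes A :: "complex ^ 'm ^ 'm"
  assumes "\<And>z. norm (A *v z) \<le> b * norm z"
  shows "op_norm A \<le> b"
  unfolding op_norm_def using assms by (rule onorm_le)

lemma op_norm_mult_le: "op_norm (A ** B) \<le> op_norm A * op_norm B" for A :: "complex ^ 'm ^ 'm"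
proof (rule op_norm_leI)
  fix z
  have "norm ((A ** B) *v z) \<le> op_norm A * norm (B *v z)"
    by (simp add: norm_matrix_vector_le flip: matrix_vector_mul_assoc)
  also have "\<dots> \<le> op_norm A * (op_norm B * norm z)"
    by (intro mult_left_mono norm_matrix_vector_le op_norm_nonneg)
  finally show "norm ((A ** B) *v z) \<le> op_norm A * op_norm B * norm z" by (simp add: mult.assoc)
qed

lemma op_norm_mat_1: "op_norm (mat 1 :: complex ^ 'm ^ 'm) = 1"
  by (simp add: op_norm_def onorm_id)

text \<open>Cauchy-Schwarz for the squared norm of \<open>conj_transpose A *v z\<close> gives one
  inequality for every matrix; its instance at the conjugate transpose is the other.\<close>

lemma op_norm_conj_transpose: "op_norm (conj_transpose A) = op_norm A"
proof -
  have le: "op_norm (conj_transpose A) \<le> op_norm A" for A :: "complex ^ 'm ^ 'm"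
  proof (rule op_norm_leI)
    fix z
    let ?v = "conj_transpose A *v z"
    have "(norm ?v)\<^sup>2 = inner ?v ?v" by (simp add: power2_norm_eq_inner)
    also have "\<dots> = inner (A *v ?v) z"
      using cinner_conj_transpose[of "conj_transpose A" z ?v] cinner_cnj[of z "A *v ?v"]
      by (simp add: inner_eq_Re_cinner complex_eq_iff)
    also have "\<dots> \<le> norm (A *v ?v) * norm z" by (rule norm_cauchy_schwarz)
    also have "\<dots> \<le> op_norm A * norm ?v * norm z" by (intro mult_right_mono norm_matrix_vector_le) simp
    finally show "norm ?v \<le> op_norm A * norm z"
      by (cases "?v = 0") (auto simp: power2_eq_square op_norm_nonneg mult.commute mult.left_commute)
  qed
  from le[of A] le[of "conj_transpose A"] show ?thesis by simp
qed

lemma norm_axis_le_op_norm: "norm (A *v axis i 1) \<le> op_norm A" for A :: "complex ^ 'm ^ 'm"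
  using norm_matrix_vector_le[of A "axis i 1"] by simp

text \<open>Reducing operators control one vector at a time; the bound by columns transfers this
  control to matrices.\<close>

lemma op_norm_le_sum: "op_norm A \<le> (\<Sum>i\<in>UNIV. norm (A *v axis i 1))" for A :: "complex ^ 'm ^ 'm"
proof (rule op_norm_leI)
  fix z :: "complex ^ 'm"
  have "A *v z = A *v (\<Sum>i\<in>UNIV. z $ i *s axis i 1)" by (simp add: basis_expansion)
  also have "\<dots> = (\<Sum>i\<in>UNIV. z $ i *s (A *v axis i 1))"
    by (simp add: vec.linear_sum[OF matrix_vector_mul_linear_gen] vector_scalar_commute)
  also have "norm \<dots> \<le> (\<Sum>i\<in>UNIV. norm z * norm (A *v axis i 1))"
  proof (rule sum_norm_le)
    fix i
    have "norm (z $ i *s (A *v axis i 1)) = norm (z $ i) * norm (A *v axis i 1)"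
      by (simp add: norm_vec_def norm_mult L2_set_right_distrib)
    also have "\<dots> \<le> norm z * norm (A *v axis i 1)"
      by (intro mult_right_mono Finite_Cartesian_Product.norm_nth_le) simp
    finally show "norm (z $ i *s (A *v axis i 1)) \<le> norm z * norm (A *v axis i 1)" .
  qed
  finally show "norm (A *v z) \<le> (\<Sum>i\<in>UNIV. norm (A *v axis i 1)) * norm z"
    by (simp add: sum_distrib_left mult.commute)
qed

text \<open>Comparison with the largest summand treats exponents below and above one alike, without
  convexity.\<close>

lemma sum_powr_le:
  fixes f :: "'m::finite \<Rightarrow> real"
  assumes "\<And>i. 0 \<le> f i" "0 < p"
  shows "(\<Sum>i\<in>UNIV. f i) powr p \<le> real CARD('m) powr p * (\<Sum>i\<in>UNIV. f i powr p)"
proof -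
  define M where "M = Max (range f)"
  have le: "f i \<le> M" for i by (simp add: M_def)
  obtain k where k: "M = f k"
    using Max_in[of "range f"] by (fastforce simp: M_def)
  have "(\<Sum>i\<in>UNIV. f i) \<le> real CARD('m) * M"
    using sum_bounded_above[of UNIV f M] le by simp
  then have "(\<Sum>i\<in>UNIV. f i) powr p \<le> (real CARD('m) * M) powr p"
    using assms by (intro powr_mono2 sum_nonneg) auto
  also have "\<dots> = real CARD('m) powr p * f k powr p"
    using assms by (simp add: k powr_mult)
  also have "\<dots> \<le> real CARD('m) powr p * (\<Sum>i\<in>UNIV. f i powr p)"
    by (intro mult_left_mono member_le_sum) auto
  finally show ?thesis .
qed

lemma op_norm_powr_le_sum:
  fixes A :: "complex ^ 'm ^ 'm"
  assumes "0 < p"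
  shows "op_norm A powr p \<le> real CARD('m) powr p * (\<Sum>i\<in>UNIV. norm (A *v axis i 1) powr p)"
  by (rule order_trans[OF powr_mono2 sum_powr_le])
     (use assms op_norm_le_sum op_norm_nonneg in auto)

lemma pos_definite_invertible:
  fixes A :: "complex ^ 'm ^ 'm"
  assumes "pos_definite A"
  obtains B where "B ** A = mat 1" "A ** B = mat 1"
proof -
  have "z = 0" if "A *v z = 0" for z
    using assms that by (metis cinner_axis cinner_scale_left less_irrefl mult_zero_left pos_definite_def
        vector_smult_lzero zero_complex.sel(1))
  then have "\<exists>B. B ** A = mat 1" by (simp add: matrix_left_invertible_ker)
  then show ?thesis using that by (metis matrix_left_right_inverse)
qed

subsection \<open>Cubes, dyadic cells and the John--Nirenberg inequality\<close>

declare emeasure_completion [simp del]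

definition half_open_cube :: "real ^ 'n \<Rightarrow> real \<Rightarrow> (real ^ 'n) set" where
  "half_open_cube a l = {x. \<forall>i. a $ i \<le> x $ i \<and> x $ i < a $ i + l}"

lemma is_cube_half_open_cube: "0 < l \<Longrightarrow> is_cube (half_open_cube a l)"
  unfolding is_cube_def half_open_cube_def
  by (rule exI[of _ a], rule exI[of _ l], rule exI[of _ "\<lambda>i. {a $ i ..< a $ i + l}"]) auto

lemma is_cube_sandwich:
  assumes "is_cube Q"
  obtains a l where "0 < l" "box a (a + (\<chi> i. l)) \<subseteq> Q" "Q \<subseteq> cbox a (a + (\<chi> i. l))"
proof -
  obtain a l I where l: "0 < l"
    and I: "\<And>i. {a $ i <..< a $ i + l} \<subseteq> I i" "\<And>i. I i \<subseteq> {a $ i .. a $ i + l}"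
    and Q: "Q = {x. \<forall>i. x $ i \<in> I i}"
    using assms unfolding is_cube_def by blast
  have "box a (a + (\<chi> i. l)) \<subseteq> Q"
    using I(1) unfolding Q by (fastforce simp: mem_box_cart)
  moreover have "Q \<subseteq> cbox a (a + (\<chi> i. l))"
    using I(2) unfolding Q by (fastforce simp: mem_box_cart)
  ultimately show ?thesis using that l by blast
qed

text \<open>The faces are negligible, so completeness of \<open>lebesgue\<close> makes any set
  between the open and the closed cube measurable, whatever part of the boundary it
  contains.\<close>

lemma cube_between:
  fixes Q :: "(real ^ 'n) set"
  assumes l: "0 < l" and Q: "box a (a + (\<chi> i. l)) \<subseteq> Q" "Q \<subseteq> cbox a (a + (\<chi> i. l))"
  shows "Q \<in> sets lebesgue" "emeasure lebesgue Q = ennreal (l ^ CARD('n))"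
    and "AE x in lebesgue. x \<in> Q \<longleftrightarrow> x \<in> cbox a (a + (\<chi> i. l))"
proof -
  let ?B = "box a (a + (\<chi> i. l))" and ?C = "cbox a (a + (\<chi> i. l))"
  have null: "?C - ?B \<in> null_sets lebesgue"
    using negligible_frontier_interval by (simp add: negligible_iff_null_sets)
  then have "Q - ?B \<in> null_sets lebesgue"
    using Q by (meson Diff_mono null_sets_completion_subset order_refl)
  moreover have "Q = ?B \<union> (Q - ?B)" using Q by auto
  ultimately show sets: "Q \<in> sets lebesgue"
    by (metis null_setsD2 sets.Un sets_completionI_sets sets_lborel borel_open open_box)
  show ae: "AE x in lebesgue. x \<in> Q \<longleftrightarrow> x \<in> ?C"
    using AE_not_in[OF null] by eventually_elim (use Q in auto)
  have "emeasure lebesgue Q = emeasure lebesgue ?C"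
    using ae sets by (intro emeasure_eq_AE) auto
  also have "\<dots> = ennreal (measure lborel ?C)"
    using emeasure_lborel_cbox_finite[of a "a + (\<chi> i. l)"]
    by (simp add: emeasure_eq_ennreal_measure emeasure_completion)
  also have "measure lborel ?C = l ^ CARD('n)"
    using l by (subst content_cbox_cart) (auto simp: interval_ne_empty_cart less_imp_le)
  finally show "emeasure lebesgue Q = ennreal (l ^ CARD('n))" .
qed

lemma cube_measure:
  fixes Q :: "(real ^ 'n) set"
  assumes "is_cube Q"
  shows "Q \<in> sets lebesgue" "emeasure lebesgue Q = ennreal (measure lebesgue Q)" "0 < measure lebesgue Q"
proof -
  obtain a l where *: "0 < l" "box a (a + (\<chi> i. l)) \<subseteq> Q" "Q \<subseteq> cbox a (a + (\<chi> i. l))"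
    using is_cube_sandwich[OF assms] .
  from cube_between[OF *] show "Q \<in> sets lebesgue" by simp
  from cube_between[OF *] * show "emeasure lebesgue Q = ennreal (measure lebesgue Q)" "0 < measure lebesgue Q"
    by (auto simp: measure_def)
qed

lemma half_open_cube_between:
  assumes "0 < l"
  shows "box a (a + (\<chi> i. l)) \<subseteq> half_open_cube a l" "half_open_cube a l \<subseteq> cbox a (a + (\<chi> i. l))"
  by (auto simp: half_open_cube_def mem_box_cart less_imp_le)

lemma emeasure_half_open_cube:
  "0 < l \<Longrightarrow> emeasure lebesgue (half_open_cube a l) = ennreal (l ^ CARD('n))"
  for a :: "real ^ 'n"
  using cube_between[OF _ half_open_cube_between] by blast

text \<open>Half-open cubes split exactly into half-open dyadic cells, and integrals do not see the
  change of faces.\<close>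

lemma half_open_version:
  assumes "is_cube Q"
  obtains a l where "0 < l" "AE x in lebesgue. x \<in> Q \<longleftrightarrow> x \<in> half_open_cube a l"
proof -
  obtain a l where *: "0 < l" "box a (a + (\<chi> i. l)) \<subseteq> Q" "Q \<subseteq> cbox a (a + (\<chi> i. l))"
    using is_cube_sandwich[OF assms] .
  have "AE x in lebesgue. x \<in> Q \<longleftrightarrow> x \<in> half_open_cube a l"
    using cube_between(3)[OF *] cube_between(3)[OF *(1) half_open_cube_between[OF *(1), of a]]
    by eventually_elim simp
  then show ?thesis using that * by blast
qed

lemma nn_avg_cong_set:
  assumes "AE x in lebesgue. x \<in> Q \<longleftrightarrow> x \<in> R" "Q \<in> sets lebesgue" "R \<in> sets lebesgue"
  shows "nn_avg Q f = nn_avg R f"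
proof -
  have "(\<integral>\<^sup>+x\<in>Q. ennreal (f x) \<partial>lebesgue) = (\<integral>\<^sup>+x\<in>R. ennreal (f x) \<partial>lebesgue)"
    by (rule nn_integral_cong_AE) (use assms(1) in eventually_elim, auto split: split_indicator)
  moreover have "emeasure lebesgue Q = emeasure lebesgue R"
    using assms by (rule emeasure_eq_AE)
  ultimately show ?thesis by (simp add: nn_avg_def)
qed

lemma nn_avg_le_iff:
  assumes "is_cube Q"
  shows "nn_avg Q f \<le> b \<longleftrightarrow> (\<integral>\<^sup>+x\<in>Q. ennreal (f x) \<partial>lebesgue) \<le> b * emeasure lebesgue Q"
proof -
  let ?m = "measure lebesgue Q"
  have m: "emeasure lebesgue Q = ennreal ?m" "0 < ?m" using cube_measure[OF assms] by auto
  have "X / ennreal ?m \<le> b \<longleftrightarrow> X \<le> b * ennreal ?m" for X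
  proof
    assume "X / ennreal ?m \<le> b"
    then have "X / ennreal ?m * ennreal ?m \<le> b * ennreal ?m" by (rule mult_right_mono) simp
    then show "X \<le> b * ennreal ?m" using m by (simp add: ennreal_divide_times ennreal_mult_divide_eq)
  next
    assume "X \<le> b * ennreal ?m"
    then have "X / ennreal ?m \<le> b * ennreal ?m / ennreal ?m" by (rule divide_right_mono_ennreal)
    then show "X / ennreal ?m \<le> b" using m by (simp add: ennreal_mult_divide_eq)
  qed
  then show ?thesis by (simp add: nn_avg_def m)
qed

text \<open>Applied to two densities of one measure, this turns estimates on single cubes into an
  estimate on their union.\<close>

lemma emeasure_Union_mono:
  assumes "countable S" "disjoint S" "S \<subseteq> sets M" "sets M = sets N"
    and "\<And>R. R \<in> S \<Longrightarrow> emeasure M R \<le> emeasure N R"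
  shows "emeasure M (\<Union>S) \<le> emeasure N (\<Union>S)"
proof -
  have disj: "disjoint_family_on (\<lambda>R. R) S"
    using assms(2) by (auto simp: disjoint_family_on_def disjoint_def pairwise_def disjnt_def)
  have "emeasure M (\<Union>R\<in>S. R) = (\<integral>\<^sup>+R. emeasure M R \<partial>count_space S)"
    using assms disj by (intro emeasure_UN_countable) auto
  also have "\<dots> \<le> (\<integral>\<^sup>+R. emeasure N R \<partial>count_space S)"
    using assms by (intro nn_integral_mono) auto
  also have "\<dots> = emeasure N (\<Union>R\<in>S. R)"
    using assms disj by (intro emeasure_UN_countable[symmetric]) auto
  finally show ?thesis by simp
qed

lemma set_nn_integral_Union_mono:
  fixes f g :: "'a \<Rightarrow> ennreal"
  assumes "countable S" "disjoint S" "S \<subseteq> sets M" "f \<in> borel_measurable M" "g \<in> borel_measurable M"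
    and "\<And>R. R \<in> S \<Longrightarrow> (\<integral>\<^sup>+x\<in>R. f x \<partial>M) \<le> (\<integral>\<^sup>+x\<in>R. g x \<partial>M)"
  shows "(\<integral>\<^sup>+x\<in>\<Union>S. f x \<partial>M) \<le> (\<integral>\<^sup>+x\<in>\<Union>S. g x \<partial>M)"
proof -
  have U: "\<Union>S \<in> sets M" using assms by (intro sets.countable_Union) auto
  have "emeasure (density M f) (\<Union>S) \<le> emeasure (density M g) (\<Union>S)"
    using assms by (intro emeasure_Union_mono) (auto simp: emeasure_density subset_iff)
  then show ?thesis using U assms by (simp add: emeasure_density)
qed

text \<open>Dyadic cells of generation \<open>k\<close> of the grid with origin \<open>a\<close> and mesh \<open>l\<close>, as the classes of
  an equivalence relation: being nested or disjoint then needs no indices.\<close>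

definition cell :: "real ^ 'n \<Rightarrow> real \<Rightarrow> nat \<Rightarrow> real ^ 'n \<Rightarrow> (real ^ 'n) set" where
  "cell a l k x = {y. \<forall>i. \<lfloor>2 ^ k * ((y $ i - a $ i) / l)\<rfloor> = \<lfloor>2 ^ k * ((x $ i - a $ i) / l)\<rfloor>}"

lemma cell_refl [simp]: "x \<in> cell a l k x"
  by (simp add: cell_def)

lemma cell_eq: "y \<in> cell a l k x \<Longrightarrow> cell a l k y = cell a l k x"
  by (auto simp: cell_def)

lemma cell_Suc_subset: "cell a l (Suc k) x \<subseteq> cell a l k x"
proof
  fix y assume y: "y \<in> cell a l (Suc k) x"
  \<comment> \<open>Halving and rounding down turns the index of a cell into that of its
    parent.\<close>
  have floor_double: "\<lfloor>t\<rfloor> = \<lfloor>2 * t\<rfloor> div 2" for t :: real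
    by linarith
  show "y \<in> cell a l k x"
    using y unfolding cell_def floor_double[of "2 ^ k * _"] by (simp add: mult.assoc)
qed

lemma cell_antimono: "j \<le> k \<Longrightarrow> cell a l k x \<subseteq> cell a l j x"
  by (rule lift_Suc_antimono_le[of "\<lambda>k. cell a l k x"]) (rule cell_Suc_subset)

lemma cell_eq_half_open_cube:
  assumes "0 < l"
  obtains b where "cell a l k x = half_open_cube b (l / 2 ^ k)"
proof
  let ?b = "\<chi> i. a $ i + l / 2 ^ k * of_int \<lfloor>2 ^ k * ((x $ i - a $ i) / l)\<rfloor>"
  have "\<lfloor>2 ^ k * ((y - a) / l)\<rfloor> = n \<longleftrightarrow>
      a + l / 2 ^ k * of_int n \<le> y \<and> y < a + l / 2 ^ k * of_int n + l / 2 ^ k" for y a :: real and n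
  proof -
    have "of_int n \<le> 2 ^ k * ((y - a) / l) \<longleftrightarrow> a + l / 2 ^ k * of_int n \<le> y"
      using assms by (simp add: field_simps)
    moreover have "2 ^ k * ((y - a) / l) < of_int n + 1 \<longleftrightarrow> y < a + l / 2 ^ k * of_int n + l / 2 ^ k"
      using assms by (simp add: field_simps)
    ultimately show ?thesis by (simp add: floor_eq_iff)
  qed
  then show "cell a l k x = half_open_cube ?b (l / 2 ^ k)"
    by (simp add: cell_def half_open_cube_def)
qed

lemma is_cube_cell: "0 < l \<Longrightarrow> is_cube (cell a l k x)"
  by (metis cell_eq_half_open_cube is_cube_half_open_cube divide_pos_pos zero_less_numeral zero_less_power)

lemma emeasure_cell:
  fixes a :: "real ^ 'n"
  assumes "0 < l" shows "emeasure lebesgue (cell a l k x) = ennreal ((l / 2 ^ k) ^ CARD('n))"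
  by (metis assms cell_eq_half_open_cube emeasure_half_open_cube divide_pos_pos zero_less_numeral zero_less_power)

lemma cell_0:
  assumes "0 < l" "x \<in> half_open_cube a l" shows "cell a l 0 x = half_open_cube a l"
proof -
  have "\<lfloor>(y - c) / l\<rfloor> = 0 \<longleftrightarrow> c \<le> y \<and> y < c + l" for y c
    using assms(1) unfolding floor_eq_iff by (simp add: field_simps)
  note * = this
  have "\<lfloor>(x $ i - a $ i) / l\<rfloor> = 0" for i
    using assms(2) unfolding * half_open_cube_def by blast
  then have "cell a l 0 x = {y. \<forall>i. \<lfloor>(y $ i - a $ i) / l\<rfloor> = 0}" by (simp add: cell_def)
  then show ?thesis unfolding * half_open_cube_def .
qed

lemma cell_subset_open:
  assumes "0 < l" "open U" "x \<in> U"
  obtains k where "cell a l k x \<subseteq> U"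
proof -
  obtain e where e: "0 < e" "ball x e \<subseteq> U" using assms open_contains_ball by blast
  define n where "n = real CARD('a)"
  have "0 < e / (l * n)" using e assms by (simp add: n_def)
  then obtain k where k: "(1 / 2) ^ k < e / (l * n)"
    using real_arch_pow_inv[of _ "1/2"] by fastforce
  have "cell a l k x \<subseteq> ball x e"
  proof
    fix y assume y: "y \<in> cell a l k x"
    obtain b where b: "cell a l k x = half_open_cube b (l / 2 ^ k)"
      using cell_eq_half_open_cube[OF assms(1)] .
    have "x \<in> half_open_cube b (l / 2 ^ k)" "y \<in> half_open_cube b (l / 2 ^ k)"
      using y cell_refl b by blast+
    then have d: "\<bar>(x - y) $ i\<bar> \<le> l / 2 ^ k" for i
      unfolding half_open_cube_def by (smt (verit) mem_Collect_eq vector_minus_component)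
    have "norm (x - y) \<le> (\<Sum>i\<in>UNIV. \<bar>(x - y) $ i\<bar>)" by (rule norm_le_l1_cart)
    also have "\<dots> \<le> n * (l / 2 ^ k)"
      unfolding n_def using d by (intro sum_bounded_above)
    also have "\<dots> < e"
      using k assms(1) by (simp add: n_def field_simps)
    finally show "y \<in> ball x e" by (simp add: dist_norm)
  qed
  then show ?thesis using that e by blast
qed

lemma countable_cells: "countable {cell a l k x |k x. True}" for a :: "real ^ 'n"
proof -
  let ?f = "\<lambda>(k :: nat, v :: int ^ 'n). {y. \<forall>i. \<lfloor>2 ^ k * ((y $ i - a $ i) / l)\<rfloor> = v $ i}"
  have "{cell a l k x |k x. True} \<subseteq> range ?f"
  proof clarify
    fix k x
    show "cell a l k x \<in> range ?f"
      by (rule image_eqI[of _ _ "(k, \<chi> i. \<lfloor>2 ^ k * ((x $ i - a $ i) / l)\<rfloor>)"]) (auto simp: cell_def)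
  qed
  then show ?thesis by (rule countable_subset) simp
qed

section \<open>Stopping cells and the Calderon-Zygmund decomposition\<close>

text \<open>Used with two predicates: a large average, for the stopping cells, and lying in an open
  set while meeting the exceptional set, for the covering of the latter.\<close>

definition maximal_cells ::
  "real ^ 'n \<Rightarrow> real \<Rightarrow> ((real ^ 'n) set \<Rightarrow> bool) \<Rightarrow> (real ^ 'n) set set" where
  "maximal_cells a l P = {cell a l k x |k x. x \<in> half_open_cube a l \<and>
     P (cell a l k x) \<and> (\<forall>j<k. \<not> P (cell a l j x))}"

lemma countable_maximal_cells: "countable (maximal_cells a l P)"
  by (rule countable_subset[OF _ countable_cells]) (auto simp: maximal_cells_def)

text \<open>Two such cells with a common point \<open>z\<close> belong to the one chain of cells
  around \<open>z\<close>, and the first generation with \<open>P\<close> on that chain is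
  unique.\<close>

lemma disjoint_maximal_cells: "disjoint (maximal_cells a l P)"
proof (rule disjointI)
  fix R R' assume "R \<in> maximal_cells a l P" "R' \<in> maximal_cells a l P" "R \<noteq> R'"
  then obtain k x k' x' where R: "R = cell a l k x" "P R" "\<And>j. j < k \<Longrightarrow> \<not> P (cell a l j x)"
    and R': "R' = cell a l k' x'" "P R'" "\<And>j. j < k' \<Longrightarrow> \<not> P (cell a l j x')"
    by (auto simp: maximal_cells_def)
  show "R \<inter> R' = {}"
  proof (rule ccontr)
    assume "R \<inter> R' \<noteq> {}"
    then obtain z where z: "z \<in> R" "z \<in> R'" by blast
    have eq: "cell a l j z = cell a l j x" if "j \<le> k" for j
      using cell_antimono[OF that] z R by (intro cell_eq) auto
    have eq': "cell a l j z = cell a l j x'" if "j \<le> k'" for j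
      using cell_antimono[OF that] z R' by (intro cell_eq) auto
    have "k = k'"
    proof (rule linorder_cases[of k k'])
      assume "k < k'" then show ?thesis using R R'(3)[of k] eq[of k] eq'[of k] by auto
    next
      assume "k' < k" then show ?thesis using R' R(3)[of k'] eq[of k'] eq'[of k'] by auto
    qed
    then show False using R R' eq eq' \<open>R \<noteq> R'\<close> by auto
  qed
qed

lemma maximal_cellsD:
  assumes "R \<in> maximal_cells a l P" "0 < l"
  shows "P R" "is_cube R" "R \<subseteq> half_open_cube a l" "R \<in> sets lebesgue"
proof -
  obtain k x where *: "R = cell a l k x" "x \<in> half_open_cube a l" "P R"
    using assms(1) by (auto simp: maximal_cells_def)
  show "P R" "is_cube R" "R \<in> sets lebesgue"
    using * is_cube_cell[OF assms(2)] cube_measure(1) by auto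
  show "R \<subseteq> half_open_cube a l"
    using * cell_antimono[of 0 k a l x] cell_0[OF assms(2) *(2)] by blast
qed

lemma Union_maximal_cellsI:
  assumes "x \<in> half_open_cube a l" "P (cell a l k x)"
  shows "x \<in> \<Union>(maximal_cells a l P)"
proof -
  define j where "j = (LEAST j. P (cell a l j x))"
  have "P (cell a l j x)" "\<And>i. i < j \<Longrightarrow> \<not> P (cell a l i x)"
    unfolding j_def using assms(2) by (auto intro: LeastI dest: not_less_Least)
  then have "cell a l j x \<in> maximal_cells a l P"
    using assms(1) by (auto simp: maximal_cells_def)
  then show ?thesis using cell_refl by blast
qed

text \<open>The pointwise bound off the stopping cells is obtained without Lebesgue's differentiation
  theorem: the exceptional set is covered by cells that are not stopping cells and whose total
  measure is arbitrarily close to that of the exceptional set.\<close>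

lemma Calderon_Zygmund:
  fixes g :: "real ^ 'n \<Rightarrow> real"
  assumes g [measurable]: "g \<in> borel_measurable lebesgue" and l: "0 < l" and s: "0 < s"
    and avg: "nn_avg (half_open_cube a l) g \<le> ennreal (s / 2)"
  obtains S where "countable S" "disjoint S"
    "\<And>R. R \<in> S \<Longrightarrow> is_cube R" "\<And>R. R \<in> S \<Longrightarrow> R \<subseteq> half_open_cube a l"
    "\<And>R. R \<in> S \<Longrightarrow> nn_avg R g \<le> ennreal (2 ^ CARD('n) * s)"
    "emeasure lebesgue (\<Union>S) \<le> ennreal (1 / 2) * emeasure lebesgue (half_open_cube a l)"
    "AE x in lebesgue. x \<in> half_open_cube a l \<longrightarrow> x \<notin> \<Union>S \<longrightarrow> g x \<le> s"
proof -
  let ?Q = "half_open_cube a l"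
  define bad where "bad R \<longleftrightarrow> ennreal s * emeasure lebesgue R < (\<integral>\<^sup>+x\<in>R. ennreal (g x) \<partial>lebesgue)" for R
  define S where "S = maximal_cells a l bad"
  have Q [measurable]: "?Q \<in> sets lebesgue" and Qcube: "is_cube ?Q"
    using is_cube_half_open_cube[OF l] cube_measure by auto
  have Qfin: "emeasure lebesgue ?Q < \<infinity>" using l by (simp add: emeasure_half_open_cube)
  have int_Q: "(\<integral>\<^sup>+x\<in>?Q. ennreal (g x) \<partial>lebesgue) \<le> ennreal (s / 2) * emeasure lebesgue ?Q"
    using avg nn_avg_le_iff[OF Qcube] by blast
  have notbad_Q: "\<not> bad ?Q"
  proof -
    have "ennreal (s / 2) * emeasure lebesgue ?Q \<le> ennreal s * emeasure lebesgue ?Q"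
      using s by (intro mult_right_mono ennreal_leI) auto
    then show ?thesis using int_Q by (auto simp: bad_def)
  qed
  have sub: "\<Union>S \<subseteq> ?Q" and sets_S: "S \<subseteq> sets lebesgue"
    unfolding S_def using maximal_cellsD(3,4)[OF _ l] by blast+
  have US [measurable]: "\<Union>S \<in> sets lebesgue"
    using sets_S countable_maximal_cells unfolding S_def by (intro sets.countable_Union) auto
  have avg_S: "nn_avg R g \<le> ennreal (2 ^ CARD('n) * s)" if R_in: "R \<in> S" for R
  proof -
    obtain k x where R: "R = cell a l k x" "x \<in> ?Q" "bad R" "\<And>j. j < k \<Longrightarrow> \<not> bad (cell a l j x)"
      using R_in by (auto simp: S_def maximal_cells_def)
    \<comment> \<open>The root cube is not bad, so a stopping cell has a parent. The parent is not
      bad by minimality and has \<open>2 ^ CARD('n)\<close> times the measure, whence the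
      constant.\<close>
    have "k \<noteq> 0" using R notbad_Q cell_0[OF l] by metis
    then obtain j where j: "k = Suc j" by (cases k) auto
    let ?R' = "cell a l j x"
    have "(\<integral>\<^sup>+x\<in>R. ennreal (g x) \<partial>lebesgue) \<le> (\<integral>\<^sup>+x\<in>?R'. ennreal (g x) \<partial>lebesgue)"
      using cell_Suc_subset[of a l j x] by (intro nn_integral_mono) (auto simp: R j split: split_indicator)
    also have "\<dots> \<le> ennreal s * emeasure lebesgue ?R'"
      using R(4)[of j] by (simp add: bad_def j)
    also have "emeasure lebesgue ?R' = ennreal (2 ^ CARD('n)) * emeasure lebesgue R"
      using l by (simp add: R j emeasure_cell power_divide power_mult_distrib field_simps flip: ennreal_mult)
    finally show ?thesis
      unfolding R(1) nn_avg_le_iff[OF is_cube_cell[OF l]] using s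
      by (simp add: ennreal_mult mult_ac)
  qed
  have meas_S: "emeasure lebesgue (\<Union>S) \<le> ennreal (1 / 2) * emeasure lebesgue ?Q"
  proof -
    have "ennreal s * emeasure lebesgue (\<Union>S) = (\<integral>\<^sup>+x\<in>\<Union>S. ennreal s \<partial>lebesgue)"
      by (simp add: nn_integral_cmult_indicator)
    also have "\<dots> \<le> (\<integral>\<^sup>+x\<in>\<Union>S. ennreal (g x) \<partial>lebesgue)"
    proof (rule set_nn_integral_Union_mono)
      fix R assume R: "R \<in> S"
      then have "bad R" "R \<in> sets lebesgue" using maximal_cellsD[OF _ l] by (auto simp: S_def)
      then show "(\<integral>\<^sup>+x\<in>R. ennreal s \<partial>lebesgue) \<le> (\<integral>\<^sup>+x\<in>R. ennreal (g x) \<partial>lebesgue)"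
        by (simp add: nn_integral_cmult_indicator bad_def less_imp_le)
    qed (use sets_S countable_maximal_cells disjoint_maximal_cells in \<open>auto simp: S_def\<close>)
    also have "\<dots> \<le> (\<integral>\<^sup>+x\<in>?Q. ennreal (g x) \<partial>lebesgue)"
      using sub by (intro nn_integral_mono) (auto split: split_indicator)
    also have "\<dots> \<le> ennreal (s / 2) * emeasure lebesgue ?Q" by (rule int_Q)
    also have "\<dots> = ennreal s * (ennreal (1 / 2) * emeasure lebesgue ?Q)"
    proof -
      have "ennreal (s / 2) = ennreal s * ennreal (1 / 2)" using s by (subst ennreal_mult[symmetric]) auto
      then show ?thesis by (simp only: mult.assoc)
    qed
    finally show ?thesis using s by (simp add: ennreal_mult_le_mult_iff)
  qed
  define N where "N = {x \<in> ?Q. x \<notin> \<Union>S \<and> s < g x}"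
  have N [measurable]: "N \<in> sets lebesgue"
  proof -
    have "N = (?Q - \<Union>S) \<inter> {x \<in> space lebesgue. s < g x}" by (auto simp: N_def)
    also have "\<dots> \<in> sets lebesgue" by measurable
    finally show ?thesis .
  qed
  have Nfin: "emeasure lebesgue N < \<infinity>"
    using emeasure_mono[of N ?Q lebesgue] Qfin by (auto simp: N_def intro: le_less_trans)
  \<comment> \<open>No cell around a point of \<open>N\<close> is bad, since otherwise the point
    would lie in a stopping cell. Covering \<open>N\<close> by such cells inside \<open>U\<close>
    bounds the integral of \<open>g\<close> by \<open>s\<close> times a measure that exceeds that of
    \<open>N\<close> by at most \<open>e / s\<close>.\<close>
  have int_N_eps: "(\<integral>\<^sup>+x\<in>N. ennreal (g x) \<partial>lebesgue) \<le> ennreal s * emeasure lebesgue N + ennreal e"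
    if e: "0 < e" for e
  proof -
    obtain U where U: "open U" "N \<subseteq> U" "(U - N) \<in> lmeasurable" "emeasure lebesgue (U - N) < ennreal (e / s)"
      using sets_lebesgue_outer_open[OF N, of "e / s"] e s by auto
    define T where "T = maximal_cells a l (\<lambda>R. R \<subseteq> U \<and> R \<inter> N \<noteq> {})"
    have "N \<subseteq> \<Union>T"
    proof
      fix x assume x: "x \<in> N"
      then obtain k where "cell a l k x \<subseteq> U"
        using cell_subset_open[OF l U(1), of x] U(2) by blast
      then show "x \<in> \<Union>T"
        unfolding T_def using x by (intro Union_maximal_cellsI[of _ _ _ _ k]) (auto simp: N_def intro: cell_refl)
    qed
    have "\<Union>T \<subseteq> U" and sets_T: "T \<subseteq> sets lebesgue"
      using maximal_cellsD[OF _ l] by (auto simp: T_def)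
    have [measurable]: "\<Union>T \<in> sets lebesgue"
      using sets_T countable_maximal_cells unfolding T_def by (intro sets.countable_Union) auto
    have "(\<integral>\<^sup>+x\<in>N. ennreal (g x) \<partial>lebesgue) \<le> (\<integral>\<^sup>+x\<in>\<Union>T. ennreal (g x) \<partial>lebesgue)"
      using \<open>N \<subseteq> \<Union>T\<close> by (intro nn_integral_mono) (auto split: split_indicator)
    also have "\<dots> \<le> (\<integral>\<^sup>+x\<in>\<Union>T. ennreal s \<partial>lebesgue)"
    proof (rule set_nn_integral_Union_mono)
      fix R assume R: "R \<in> T"
      then obtain k x where kx: "R = cell a l k x" by (auto simp: T_def maximal_cells_def)
      obtain z where z: "z \<in> R" "z \<in> N" using maximal_cellsD(1)[OF R[unfolded T_def] l] by blast
      then have "R = cell a l k z" using cell_eq kx by metis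
      then have "\<not> bad R"
        using Union_maximal_cellsI[of z a l bad k] z by (auto simp: N_def S_def)
      then show "(\<integral>\<^sup>+x\<in>R. ennreal (g x) \<partial>lebesgue) \<le> (\<integral>\<^sup>+x\<in>R. ennreal s \<partial>lebesgue)"
        using R sets_T by (auto simp: nn_integral_cmult_indicator bad_def)
    qed (use sets_T countable_maximal_cells disjoint_maximal_cells in \<open>auto simp: T_def\<close>)
    also have "\<dots> = ennreal s * emeasure lebesgue (\<Union>T)"
      by (simp add: nn_integral_cmult_indicator)
    also have "\<dots> \<le> ennreal s * emeasure lebesgue (N \<union> (U - N))"
      using \<open>\<Union>T \<subseteq> U\<close> U by (intro mult_left_mono emeasure_mono) auto
    also have "\<dots> \<le> ennreal s * (emeasure lebesgue N + ennreal (e / s))"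
      using U by (intro mult_left_mono order_trans[OF emeasure_subadditive] add_left_mono) auto
    also have "\<dots> = ennreal s * emeasure lebesgue N + ennreal e"
      using e s by (simp add: distrib_left flip: ennreal_mult)
    finally show ?thesis .
  qed
  have "(\<integral>\<^sup>+x\<in>N. ennreal (g x) \<partial>lebesgue) \<le> ennreal s * emeasure lebesgue N"
    by (rule ennreal_le_epsilon) (rule int_N_eps)
  \<comment> \<open>Cancelling the finite term \<open>ennreal s * emeasure lebesgue N\<close> leaves
    a vanishing integral of \<open>g x - s\<close>, which is positive on \<open>N\<close>; so
    \<open>N\<close> is null.\<close>
  moreover have "(\<integral>\<^sup>+x\<in>N. ennreal (g x) \<partial>lebesgue)
      = (\<integral>\<^sup>+x\<in>N. ennreal (g x - s) \<partial>lebesgue) + ennreal s * emeasure lebesgue N"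
  proof -
    have "(\<integral>\<^sup>+x\<in>N. ennreal (g x) \<partial>lebesgue)
        = (\<integral>\<^sup>+x. ennreal (g x - s) * indicator N x + ennreal s * indicator N x \<partial>lebesgue)"
      using s by (intro nn_integral_cong) (auto simp: N_def split: split_indicator simp flip: ennreal_plus)
    then show ?thesis by (simp add: nn_integral_add nn_integral_cmult_indicator)
  qed
  moreover have "ennreal s * emeasure lebesgue N < \<infinity>" using Nfin by (simp add: ennreal_mult_less_top)
  ultimately have "ennreal s * emeasure lebesgue N + (\<integral>\<^sup>+x\<in>N. ennreal (g x - s) \<partial>lebesgue)
      \<le> ennreal s * emeasure lebesgue N + 0" "ennreal s * emeasure lebesgue N \<noteq> top"
    by (auto simp: add.commute)
  then have "(\<integral>\<^sup>+x\<in>N. ennreal (g x - s) \<partial>lebesgue) = 0"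
    unfolding ennreal_add_left_cancel_le by simp
  then have "AE x in lebesgue. ennreal (g x - s) * indicator N x = 0"
    by (subst (asm) nn_integral_0_iff_AE) auto
  then have "AE x in lebesgue. x \<in> ?Q \<longrightarrow> x \<notin> \<Union>S \<longrightarrow> g x \<le> s"
    by eventually_elim (auto simp: N_def split: split_indicator_asm)
  moreover have "countable S" "disjoint S"
    unfolding S_def by (rule countable_maximal_cells, rule disjoint_maximal_cells)
  moreover have "is_cube R" "R \<subseteq> ?Q" if "R \<in> S" for R
    using that unfolding S_def by (rule maximal_cellsD(2)[OF _ l], rule maximal_cellsD(3)[OF _ l])
  ultimately show ?thesis using that[of S] avg_S meas_S by blast
qed

section \<open>Exponential integrability of a cube-dependent family\<close>

lemma nn_avg_mono:
  assumes "\<And>x. x \<in> Q \<Longrightarrow> f x \<le> g x" shows "nn_avg Q f \<le> nn_avg Q g"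
  unfolding nn_avg_def
  by (intro divide_right_mono_ennreal nn_integral_mono)
     (auto split: split_indicator intro: ennreal_leI assms)

text \<open>The supremum runs over all cubes because each stopping cube \<open>R\<close> brings its
  own function: \<open>h Q\<close> is compared with \<open>h R\<close> there, not with itself on a
  smaller cube. The resulting bound does not depend on the truncation level
  \<open>N\<close>.\<close>

lemma nn_avg_truncated_exp_le:
  fixes G :: "(real ^ 'n) set \<Rightarrow> real ^ 'n \<Rightarrow> real"
  assumes meas: "\<And>Q. is_cube Q \<Longrightarrow> G Q \<in> borel_measurable lebesgue"
    and avg: "\<And>Q. is_cube Q \<Longrightarrow> nn_avg Q (G Q) \<le> ennreal (s / 2)"
    and comp: "\<And>Q R x. is_cube Q \<Longrightarrow> is_cube R \<Longrightarrow>
      nn_avg R (G Q) \<le> ennreal (2 ^ CARD('n) * s) \<Longrightarrow> G Q x \<le> K + G R x"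
    and pos: "0 < s" "0 < u" "0 \<le> K" and u: "exp (u * K) \<le> 3 / 2"
    and Q: "is_cube Q"
  shows "nn_avg Q (\<lambda>x. exp (u * min (G Q x) (real N))) \<le> ennreal (4 * exp (u * s))"
proof -
  define h where "h Q x = exp (u * min (G Q x) (real N))" for Q x
  define A where "A = (SUP Q\<in>{Q :: (real ^ 'n) set. is_cube Q}. nn_avg Q (h Q))"
  have h_meas: "h Q \<in> borel_measurable lebesgue" if "is_cube Q" for Q
    unfolding h_def using meas[OF that] by measurable
  have le_A: "nn_avg Q (h Q) \<le> A" if "is_cube Q" for Q
    unfolding A_def using that by (auto intro: SUP_upper)
  have "nn_avg Q (h Q) \<le> ennreal (exp (u * real N))" if "is_cube Q" for Q
  proof -
    have "(\<integral>\<^sup>+x\<in>Q. ennreal (h Q x) \<partial>lebesgue) \<le> (\<integral>\<^sup>+x\<in>Q. ennreal (exp (u * real N)) \<partial>lebesgue)"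
      unfolding h_def using pos
      by (intro nn_integral_mono mult_right_mono ennreal_leI) auto
    then show ?thesis
      using cube_measure(1)[OF that] by (simp add: nn_avg_le_iff[OF that] nn_integral_cmult_indicator)
  qed
  \<comment> \<open>Finiteness of the supremum is what later allows \<open>3 / 4 * t\<close> to be
    moved to the other side.\<close>
  then have "A \<le> ennreal (exp (u * real N))" unfolding A_def by (auto intro: SUP_least)
  then obtain t where t: "A = ennreal t" "0 \<le> t" by (cases A) (auto simp: top_unique)
  have step: "nn_avg Q (h Q) \<le> ennreal (exp (u * s) + 3 / 4 * t)" if Q: "is_cube Q" for Q
  proof -
    obtain a l where l: "0 < l" and QQ: "AE x in lebesgue. x \<in> Q \<longleftrightarrow> x \<in> half_open_cube a l"
      using half_open_version[OF Q] .
    let ?H = "half_open_cube a l"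
    have H: "is_cube ?H" using l by (rule is_cube_half_open_cube)
    have avg_eq: "nn_avg Q f = nn_avg ?H f" for f
      using nn_avg_cong_set[OF QQ] cube_measure(1) Q H by blast
    note [measurable] = meas[OF Q] h_meas[OF Q] cube_measure(1)[OF H]
    obtain S where S: "countable S" "disjoint S"
        "\<And>R. R \<in> S \<Longrightarrow> is_cube R" "\<And>R. R \<in> S \<Longrightarrow> R \<subseteq> ?H"
        "\<And>R. R \<in> S \<Longrightarrow> nn_avg R (G Q) \<le> ennreal (2 ^ CARD('n) * s)"
        "emeasure lebesgue (\<Union>S) \<le> ennreal (1 / 2) * emeasure lebesgue ?H"
      and good: "AE x in lebesgue. x \<in> ?H \<longrightarrow> x \<notin> \<Union>S \<longrightarrow> G Q x \<le> s"
      using Calderon_Zygmund[OF meas[OF Q] l pos(1) avg[OF Q, unfolded avg_eq]] by blast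
    have sets_S: "S \<subseteq> sets lebesgue" using S(3) cube_measure(1) by auto
    then have [measurable]: "\<Union>S \<in> sets lebesgue" using S(1) by (intro sets.countable_Union)
    have "(\<integral>\<^sup>+x\<in>?H. ennreal (h Q x) \<partial>lebesgue)
        \<le> (\<integral>\<^sup>+x. ennreal (exp (u * s)) * indicator ?H x + ennreal (h Q x) * indicator (\<Union>S) x \<partial>lebesgue)"
    proof (rule nn_integral_mono_AE)
      show "AE x in lebesgue. ennreal (h Q x) * indicator ?H x
          \<le> ennreal (exp (u * s)) * indicator ?H x + ennreal (h Q x) * indicator (\<Union>S) x"
        using good
      proof eventually_elim
        case (elim x)
        show ?case
        proof (cases "x \<in> ?H \<and> x \<notin> \<Union>S")
          case True
          then have "h Q x \<le> exp (u * s)" using elim pos by (auto simp: h_def)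
          then show ?thesis using True by (auto intro: ennreal_leI)
        qed (auto split: split_indicator)
      qed
    qed
    also have "\<dots> = ennreal (exp (u * s)) * emeasure lebesgue ?H + (\<integral>\<^sup>+x\<in>\<Union>S. ennreal (h Q x) \<partial>lebesgue)"
      by (simp add: nn_integral_add nn_integral_cmult_indicator)
    also have "(\<integral>\<^sup>+x\<in>\<Union>S. ennreal (h Q x) \<partial>lebesgue) \<le> (\<integral>\<^sup>+x\<in>\<Union>S. ennreal (3 / 2 * t) \<partial>lebesgue)"
    proof (rule set_nn_integral_Union_mono)
      fix R assume R: "R \<in> S"
      note [measurable] = h_meas[OF S(3)[OF R]] cube_measure(1)[OF S(3)[OF R]]
      have "h Q x \<le> 3 / 2 * h R x" for x
      proof -
        \<comment> \<open>Truncation preserves the comparison because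
          \<open>0 \<le> K\<close>.\<close>
        have "min (G Q x) (real N) \<le> K + min (G R x) (real N)"
          using comp[OF Q S(3)[OF R] S(5)[OF R], of x] pos by linarith
        then have "u * min (G Q x) (real N) \<le> u * K + u * min (G R x) (real N)"
          using pos by (metis distrib_left mult_left_mono less_imp_le)
        then have "h Q x \<le> exp (u * K) * h R x" by (simp add: h_def flip: exp_add)
        also have "\<dots> \<le> 3 / 2 * h R x" using u by (intro mult_right_mono) (auto simp: h_def)
        finally show ?thesis .
      qed
      then have "(\<integral>\<^sup>+x\<in>R. ennreal (h Q x) \<partial>lebesgue) \<le> (\<integral>\<^sup>+x\<in>R. ennreal (3 / 2 * h R x) \<partial>lebesgue)"
        by (intro nn_integral_mono mult_right_mono ennreal_leI) auto
      also have "\<dots> = ennreal (3 / 2) * (\<integral>\<^sup>+x\<in>R. ennreal (h R x) \<partial>lebesgue)"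
      proof -
        have "ennreal (3 / 2 * y) = ennreal (3 / 2) * ennreal y" for y by (rule ennreal_mult') simp
        then show ?thesis by (simp only: mult.assoc) (rule nn_integral_cmult, measurable)
      qed
      also have "\<dots> \<le> ennreal (3 / 2) * (ennreal t * emeasure lebesgue R)"
        using le_A[OF S(3)[OF R]] unfolding t(1) nn_avg_le_iff[OF S(3)[OF R]] by (intro mult_left_mono) auto
      also have "\<dots> = ennreal (3 / 2 * t) * emeasure lebesgue R"
        using t(2) by (simp only: ennreal_mult[of "3 / 2" t] mult.assoc)
      also have "\<dots> = (\<integral>\<^sup>+x\<in>R. ennreal (3 / 2 * t) \<partial>lebesgue)"
        by (rule nn_integral_cmult_indicator[symmetric]) (rule cube_measure(1)[OF S(3)[OF R]])
      finally show "(\<integral>\<^sup>+x\<in>R. ennreal (h Q x) \<partial>lebesgue) \<le> (\<integral>\<^sup>+x\<in>R. ennreal (3 / 2 * t) \<partial>lebesgue)" .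
    qed (use S sets_S in auto)
    also have "\<dots> = ennreal (3 / 2 * t) * emeasure lebesgue (\<Union>S)"
      by (simp add: nn_integral_cmult_indicator)
    also have "\<dots> \<le> ennreal (3 / 2 * t) * (ennreal (1 / 2) * emeasure lebesgue ?H)"
      using S(6) by (intro mult_left_mono) auto
    also have "\<dots> = ennreal (3 / 4 * t) * emeasure lebesgue ?H"
    proof -
      have "ennreal (3 / 4 * t) = ennreal (3 / 2 * t) * ennreal (1 / 2)"
        using t by (subst ennreal_mult[symmetric]) auto
      then show ?thesis by (simp only: mult.assoc)
    qed
    finally have "(\<integral>\<^sup>+x\<in>?H. ennreal (h Q x) \<partial>lebesgue) \<le> ennreal (exp (u * s) + 3 / 4 * t) * emeasure lebesgue ?H"
      using t by (simp add: distrib_right ennreal_plus)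
    then show ?thesis unfolding avg_eq nn_avg_le_iff[OF H] .
  qed
  \<comment> \<open>Absorbing the term \<open>3 / 4 * t\<close> produces the factor 4.\<close>
  have "ennreal t \<le> ennreal (exp (u * s) + 3 / 4 * t)"
    unfolding t(1)[symmetric] unfolding A_def using step by (auto intro: SUP_least)
  then have "t \<le> exp (u * s) + 3 / 4 * t" using t(2) by (subst (asm) ennreal_le_iff) auto
  then have "A \<le> ennreal (4 * exp (u * s))" unfolding t by (intro ennreal_leI) linarith
  then show ?thesis using le_A[OF Q] by (auto simp: h_def[abs_def] intro: order_trans)
qed

lemma John_Nirenberg:
  fixes G :: "(real ^ 'n) set \<Rightarrow> real ^ 'n \<Rightarrow> real"
  assumes meas: "\<And>Q. is_cube Q \<Longrightarrow> G Q \<in> borel_measurable lebesgue"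
    and avg: "\<And>Q. is_cube Q \<Longrightarrow> nn_avg Q (G Q) \<le> ennreal b"
    and comp: "\<And>Q R s x. is_cube Q \<Longrightarrow> is_cube R \<Longrightarrow> 0 \<le> s \<Longrightarrow>
      nn_avg R (G Q) \<le> ennreal s \<Longrightarrow> G Q x \<le> K + s + G R x"
    and pos: "0 < b" "0 \<le> K"
  obtains u M where "0 < u" "\<And>Q. is_cube Q \<Longrightarrow> nn_avg Q (\<lambda>x. exp (u * G Q x)) \<le> ennreal M"
proof -
  \<comment> \<open>The stopping height is \<open>2 * b\<close>, twice the bound on the averages, so
    averages on stopping cubes are at most \<open>2 ^ CARD('n) * (2 * b)\<close>. Taking this as
    \<open>s\<close> in \<open>comp\<close> gives \<open>K'\<close>, and \<open>u\<close> solves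
    \<open>exp (u * K') = 3 / 2\<close>.\<close>
  define K' where "K' = K + 2 ^ CARD('n) * (2 * b)"
  have K': "0 < K'" using pos by (simp add: K'_def add_nonneg_pos)
  define u where "u = ln (3 / 2) / K'"
  have u: "0 < u" "exp (u * K') \<le> 3 / 2" using K' by (auto simp: u_def)
  have trunc: "nn_avg Q (\<lambda>x. exp (u * min (G Q x) (real N))) \<le> ennreal (4 * exp (u * (2 * b)))"
    if "is_cube Q" for Q N
  proof (rule nn_avg_truncated_exp_le[where K = K'])
    show "G Q x \<le> K' + G R x"
      if "is_cube Q" "is_cube R" "nn_avg R (G Q) \<le> ennreal (2 ^ CARD('n) * (2 * b))" for Q R x
      using comp[OF that(1,2) _ that(3)] pos by (simp add: K'_def)
  qed (use meas avg pos K' u that in auto)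
  have "nn_avg Q (\<lambda>x. exp (u * G Q x)) \<le> ennreal (4 * exp (u * (2 * b)))" if Q: "is_cube Q" for Q
  proof -
    note [measurable] = meas[OF Q] cube_measure(1)[OF Q]
    \<comment> \<open>The truncated bound is uniform in \<open>N\<close>, so monotone convergence
      removes the truncation.\<close>
    let ?f = "\<lambda>N x. ennreal (exp (u * min (G Q x) (real N))) * indicator Q x"
    have "ennreal (exp (u * G Q x)) * indicator Q x \<le> (SUP N. ?f N x)" for x
    proof -
      obtain N where "G Q x \<le> real N" using real_arch_simple by blast
      then have "ennreal (exp (u * G Q x)) * indicator Q x = ?f N x" by (simp add: min_absorb1)
      also have "\<dots> \<le> (SUP N. ?f N x)" by (rule SUP_upper) simp
      finally show ?thesis .
    qed
    then have "(\<integral>\<^sup>+x\<in>Q. ennreal (exp (u * G Q x)) \<partial>lebesgue) \<le> (\<integral>\<^sup>+x. (SUP N. ?f N x) \<partial>lebesgue)"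
      by (intro nn_integral_mono)
    also have "\<dots> = (SUP N. \<integral>\<^sup>+x. ?f N x \<partial>lebesgue)"
    proof (rule nn_integral_monotone_convergence_SUP)
      show "incseq ?f"
        unfolding incseq_def le_fun_def using u
        by (auto intro!: mult_right_mono ennreal_leI mult_left_mono)
    qed measurable
    also have "\<dots> \<le> ennreal (4 * exp (u * (2 * b))) * emeasure lebesgue Q"
      using trunc[OF Q] unfolding nn_avg_le_iff[OF Q] by (intro SUP_least)
    finally show ?thesis unfolding nn_avg_le_iff[OF Q] .
  qed
  then show ?thesis using that u by blast
qed

subsection \<open>Averages over cubes\<close>

text \<open>In this form monotonicity and the product rule concern \<open>ln\<close> at arguments at
  least 1 only, which covers the argument 0 as well.\<close>

lemma log_plus_eq: "0 \<le> t \<Longrightarrow> log_plus t = ln (max 1 t)"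
  by (cases "t = 0") (auto simp: log_plus_def max_def)

lemma log_plus_nonneg [simp]: "0 \<le> log_plus t"
  by (simp add: log_plus_def)

lemma log_plus_mono: "0 \<le> s \<Longrightarrow> s \<le> t \<Longrightarrow> log_plus s \<le> log_plus t"
  by (simp add: log_plus_eq)

lemma log_plus_mult_le:
  assumes "0 \<le> s" "0 \<le> t" shows "log_plus (s * t) \<le> log_plus s + log_plus t"
proof -
  have "max 1 (s * t) \<le> max 1 s * max 1 t"
    using assms mult_mono[of s "max 1 s" t "max 1 t"] mult_mono[of 1 "max 1 s" 1 "max 1 t"] by simp
  then have "ln (max 1 (s * t)) \<le> ln (max 1 s * max 1 t)" by simp
  also have "\<dots> = ln (max 1 s) + ln (max 1 t)" by (intro ln_mult_pos) auto
  finally show ?thesis using assms by (simp add: log_plus_eq)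
qed

lemma log_plus_le: "0 \<le> t \<Longrightarrow> log_plus t \<le> t"
  using ln_le_minus_one[of t] by (cases "t = 0") (auto simp: log_plus_def)

lemma log_plus_powr:
  assumes "0 \<le> t" "0 < q" shows "log_plus (t powr q) = q * log_plus t"
proof (cases "t = 0")
  case False
  then have "log_plus (t powr q) = max 0 (q * ln t)" using assms by (simp add: log_plus_def ln_powr)
  also have "\<dots> = q * log_plus t"
    using assms by (auto simp: log_plus_def max_def mult_le_0_iff zero_le_mult_iff)
  finally show ?thesis .
qed (simp add: log_plus_def)

lemma powr_le_exp_log_plus:
  assumes "0 \<le> t" "0 \<le> u" shows "t powr u \<le> exp (u * log_plus t)"
proof -
  have "t powr u \<le> max 1 t powr u" using assms by (intro powr_mono2) auto
  also have "max 1 t powr u = exp (u * log_plus t)"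
    using assms by (simp only: log_plus_eq powr_def) simp
  finally show ?thesis .
qed

lemma log_plus_measurable [measurable]: "log_plus \<in> borel_measurable borel"
  unfolding log_plus_def by measurable

context
  fixes Q :: "(real ^ 'n) set" assumes Q: "is_cube Q"
begin

lemma set_integrable_const_cube: "set_integrable lebesgue Q (\<lambda>x. k :: real)"
  using cube_measure[OF Q] by (simp add: set_integrable_def ennreal_less_top)

lemma avg_const: "avg Q (\<lambda>x. k) = k"
  using cube_measure[OF Q] by (simp add: avg_def set_lebesgue_integral_def)

lemma avg_add:
  "set_integrable lebesgue Q f \<Longrightarrow> set_integrable lebesgue Q g \<Longrightarrow> avg Q (\<lambda>x. f x + g x) = avg Q f + avg Q g"
  by (simp add: avg_def add_divide_distrib)

lemma avg_diff:
  "set_integrable lebesgue Q f \<Longrightarrow> set_integrable lebesgue Q g \<Longrightarrow> avg Q (\<lambda>x. f x - g x) = avg Q f - avg Q g"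
  by (simp add: avg_def diff_divide_distrib)

lemma avg_cmult: "avg Q (\<lambda>x. k * f x) = k * avg Q f"
  by (simp add: avg_def)

lemma avg_sum:
  "(\<And>i. i \<in> I \<Longrightarrow> set_integrable lebesgue Q (f i)) \<Longrightarrow> avg Q (\<lambda>x. \<Sum>i\<in>I. f i x) = (\<Sum>i\<in>I. avg Q (f i))"
  by (simp add: avg_def set_lebesgue_integral_def set_integrable_def sum_distrib_left sum_divide_distrib)

lemma avg_mono_AE:
  assumes "set_integrable lebesgue Q f" "set_integrable lebesgue Q g" "AE x in lebesgue. x \<in> Q \<longrightarrow> f x \<le> g x"
  shows "avg Q f \<le> avg Q g"
  unfolding avg_def using assms by (intro divide_right_mono set_integral_mono_AE) auto

lemma avg_mono:
  assumes "set_integrable lebesgue Q f" "set_integrable lebesgue Q g" "\<And>x. f x \<le> g x"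
  shows "avg Q f \<le> avg Q g"
  using assms by (intro avg_mono_AE) auto

lemma avg_nonneg: "(\<And>x. 0 \<le> f x) \<Longrightarrow> 0 \<le> avg Q f"
  unfolding avg_def set_lebesgue_integral_def by (intro divide_nonneg_nonneg integral_nonneg) auto

lemma set_integrable_bound_AE:
  fixes f g :: "real ^ 'n \<Rightarrow> real"
  assumes "set_integrable lebesgue Q g" "f \<in> borel_measurable lebesgue"
    and "AE x in lebesgue. x \<in> Q \<longrightarrow> \<bar>f x\<bar> \<le> g x"
  shows "set_integrable lebesgue Q f"
proof (rule set_integrable_bound[OF assms(1)])
  show "set_borel_measurable lebesgue Q f"
    unfolding set_borel_measurable_def using cube_measure(1)[OF Q] assms(2) by measurable
  show "AE x in lebesgue. x \<in> Q \<longrightarrow> norm (f x) \<le> norm (g x)"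
    using assms(3) by eventually_elim auto
qed

lemma nn_avg_eq_avg:
  assumes "set_integrable lebesgue Q f" "\<And>x. 0 \<le> f x"
  shows "nn_avg Q f = ennreal (avg Q f)"
proof -
  have "(\<integral>\<^sup>+x\<in>Q. ennreal (f x) \<partial>lebesgue) = (\<integral>\<^sup>+x. ennreal (indicator Q x *\<^sub>R f x) \<partial>lebesgue)"
    by (intro nn_integral_cong) (auto split: split_indicator)
  also have "\<dots> = ennreal (LINT x:Q|lebesgue. f x)"
    unfolding set_lebesgue_integral_def
    using assms by (intro nn_integral_eq_integral) (auto simp: set_integrable_def)
  finally show ?thesis
    using cube_measure[OF Q] avg_nonneg[OF assms(2)]
    by (simp add: nn_avg_def avg_def divide_ennreal zero_le_divide_iff)
qed

lemma set_integrable_nn_avg: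
  assumes "f \<in> borel_measurable lebesgue" "\<And>x. 0 \<le> f x" "nn_avg Q f \<le> ennreal M"
  shows "set_integrable lebesgue Q f"
  unfolding set_integrable_def
proof (rule integrableI_nonneg)
  show "(\<lambda>x. indicator Q x *\<^sub>R f x) \<in> borel_measurable lebesgue"
    using cube_measure(1)[OF Q] assms(1) by measurable
  have "(\<integral>\<^sup>+x. ennreal (indicator Q x *\<^sub>R f x) \<partial>lebesgue) = (\<integral>\<^sup>+x\<in>Q. ennreal (f x) \<partial>lebesgue)"
    by (intro nn_integral_cong) (auto split: split_indicator)
  also have "\<dots> \<le> ennreal M * emeasure lebesgue Q"
    using assms(3) nn_avg_le_iff[OF Q] by blast
  also have "\<dots> < \<infinity>" using cube_measure(2)[OF Q] by (simp add: ennreal_mult_less_top)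
  finally show "(\<integral>\<^sup>+x. ennreal (indicator Q x *\<^sub>R f x) \<partial>lebesgue) < \<infinity>" .
qed (use assms in auto)

end

subsection \<open>Measurability\<close>

text \<open>For \<open>inner_measurable\<close>: measurability of an integral over
  \<open>lebesgue\<close> as a function of a parameter requires sigma-finiteness of the completed
  measure.\<close>

lemma sigma_finite_completion:
  assumes "sigma_finite_measure M" shows "sigma_finite_measure (completion M)"
proof -
  interpret sigma_finite_measure M by fact
  obtain B where B: "countable B" "B \<subseteq> sets M" "\<Union>B = space M" "\<forall>b\<in>B. emeasure M b \<noteq> \<infinity>"
    using sigma_finite_countable by blast
  have "emeasure (completion M) b = emeasure M b" if "b \<in> B" for b
    using that B(2) by (simp add: emeasure_completion sets_completionI_sets main_part_sets subset_iff)
  moreover have "B \<subseteq> sets (completion M)" using B(2) by blast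
  ultimately show ?thesis
    using B by (intro sigma_finite_measure.intro exI[of _ B] conjI ballI) simp_all
qed

text \<open>By continuity a bound needs testing on a dense set only; with a countable one, sublevel
  sets of the operator norm become countable intersections.\<close>

lemma op_norm_le_iff_dense:
  fixes M :: "complex ^ 'm ^ 'm"
  assumes "closure D = UNIV"
  shows "op_norm M \<le> b \<longleftrightarrow> (\<forall>z\<in>D. norm (M *v z) \<le> b * norm z)"
proof
  assume "op_norm M \<le> b"
  then show "\<forall>z\<in>D. norm (M *v z) \<le> b * norm z"
    by (meson norm_matrix_vector_le mult_right_mono norm_ge_zero order_trans)
next
  assume D: "\<forall>z\<in>D. norm (M *v z) \<le> b * norm z"
  have "closed {z. norm (M *v z) \<le> b * norm z}"
    by (intro closed_Collect_le continuous_intros matrix_vector_mult_linear_continuous_on)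
  then have "closure D \<subseteq> {z. norm (M *v z) \<le> b * norm z}"
    using D by (intro closure_minimal) auto
  then show "op_norm M \<le> b" using assms by (intro op_norm_leI) auto
qed

lemma obtain_countable_dense:
  obtains D :: "'a :: {second_countable_topology, t1_space} set" where "countable D" "closure D = UNIV"
proof -
  obtain D :: "'a set" where "countable D" "\<And>X. open X \<Longrightarrow> X \<noteq> {} \<Longrightarrow> \<exists>d\<in>D. d \<in> X"
    using countable_dense_setE by blast
  moreover from this have "closure D = UNIV"
    using closure_subset[of D] by (metis Compl_iff closed_closure double_compl Compl_UNIV_eq open_Compl subsetD)
  ultimately show ?thesis using that by blast
qed

lemma op_norm_measurable:
  fixes f :: "'a \<Rightarrow> complex ^ 'm ^ 'm"
  assumes [measurable]: "\<And>z. (\<lambda>x. norm (f x *v z)) \<in> borel_measurable M"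
  shows "(\<lambda>x. op_norm (f x)) \<in> borel_measurable M"
proof -
  obtain D :: "(complex ^ 'm) set" where D: "countable D" "closure D = UNIV"
    by (rule obtain_countable_dense)
  have "{x \<in> space M. op_norm (f x) \<le> b} \<in> sets M" for b
    unfolding op_norm_le_iff_dense[OF D(2)]
    by (intro sets.sets_Collect_countable_All' D(1)) measurable
  then show ?thesis by (simp add: borel_measurable_iff_le)
qed

text \<open>Substituting \<open>P *v z\<close> for the argument removes the inverse \<open>N\<close>
  from the condition, so measurability of the negative power of the weight reduces to that of the
  positive one.\<close>

lemma op_norm_mult_inverse_le_iff:
  fixes B P N :: "complex ^ 'm ^ 'm"
  assumes "N ** P = mat 1" "closure D = UNIV"
  shows "op_norm (B ** N) \<le> b \<longleftrightarrow> (\<forall>z\<in>D. norm (B *v z) \<le> b * norm (P *v z))"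
proof
  assume le: "op_norm (B ** N) \<le> b"
  show "\<forall>z\<in>D. norm (B *v z) \<le> b * norm (P *v z)"
  proof
    fix z
    have "B *v z = (B ** N) *v (P *v z)"
      by (metis assms(1) matrix_mul_assoc matrix_mul_rid matrix_vector_mul_assoc)
    then have "norm (B *v z) \<le> op_norm (B ** N) * norm (P *v z)"
      by (metis norm_matrix_vector_le)
    then show "norm (B *v z) \<le> b * norm (P *v z)"
      using le by (meson mult_right_mono norm_ge_zero order_trans)
  qed
next
  assume D: "\<forall>z\<in>D. norm (B *v z) \<le> b * norm (P *v z)"
  have "closed {z. norm (B *v z) \<le> b * norm (P *v z)}"
    by (intro closed_Collect_le continuous_intros matrix_vector_mult_linear_continuous_on)
  then have "closure D \<subseteq> {z. norm (B *v z) \<le> b * norm (P *v z)}"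
    using D by (intro closure_minimal) auto
  then have all: "norm (B *v z) \<le> b * norm (P *v z)" for z using assms(2) by auto
  have PN: "P ** N = mat 1" using assms(1) by (simp add: matrix_left_right_inverse)
  show "op_norm (B ** N) \<le> b"
  proof (rule op_norm_leI)
    fix z
    have "norm ((B ** N) *v z) = norm (B *v (N *v z))" by (simp add: matrix_vector_mul_assoc)
    also have "\<dots> \<le> b * norm (P *v (N *v z))" by (rule all)
    also have "P *v (N *v z) = z" by (simp add: matrix_vector_mul_assoc PN)
    finally show "norm ((B ** N) *v z) \<le> b * norm z" .
  qed
qed

lemma AE_lebesgue_null_sets: "(AE x in lebesgue. Q x) \<longleftrightarrow> {x. \<not> Q x} \<in> null_sets lebesgue"
  using completion.AE_iff_null_sets[of Q lborel] by simp

lemma borel_measurable_lebesgue_cong_AE: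
  assumes f: "f \<in> borel_measurable lebesgue" and eq: "AE x in lebesgue. f x = g x"
  shows "g \<in> borel_measurable lebesgue"
proof (rule measurableI)
  fix B :: "'b set" assume "B \<in> sets borel"
  then have B: "f -` B \<in> sets lebesgue" using measurable_sets[OF f] by simp
  have null: "{x. f x \<noteq> g x} \<in> null_sets lebesgue" using eq by (simp only: AE_lebesgue_null_sets)
  then have "{x. f x \<noteq> g x \<and> g x \<in> B} \<in> null_sets lebesgue"
    by (rule null_sets_completion_subset[rotated]) auto
  moreover have "g -` B \<inter> space lebesgue = (f -` B - {x. f x \<noteq> g x}) \<union> {x. f x \<noteq> g x \<and> g x \<in> B}"
    by auto
  ultimately show "g -` B \<inter> space lebesgue \<in> sets lebesgue"
    using B null by (simp only: sets.Un sets.Diff null_setsD2)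
qed simp

lemma set_integrable_sum:
  fixes f :: "'i \<Rightarrow> 'a \<Rightarrow> real"
  assumes "\<And>i. i \<in> I \<Longrightarrow> set_integrable M S (f i)"
  shows "set_integrable M S (\<lambda>x. \<Sum>i\<in>I. f i x)"
  using assms unfolding set_integrable_def scaleR_sum_right by (rule Bochner_Integration.integrable_sum)

subsection \<open>Weights with reducing operators\<close>

text \<open>The same \<open>c\<close> and \<open>C\<close> serve all cubes, which makes the
  constants below uniform in the cube.\<close>

locale reducing_operators =
  fixes p c C :: real
    and W :: "real ^ 'n \<Rightarrow> complex ^ 'm ^ 'm"
    and A :: "(real ^ 'n) set \<Rightarrow> complex ^ 'm ^ 'm"
  assumes p: "0 < p" and c: "0 < c" and C: "0 < C"
    and weight: "matrix_weight W"
    and reducing: "\<And>Q. is_cube Q \<Longrightarrow> reducing_operator c C p W Q (A Q)"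
begin

abbreviation P :: "real ^ 'n \<Rightarrow> complex ^ 'm ^ 'm" where "P x \<equiv> mat_powr (W x) (1 / p)"
abbreviation N :: "real ^ 'n \<Rightarrow> complex ^ 'm ^ 'm" where "N x \<equiv> mat_powr (W x) (- (1 / p))"

lemma N_P_AE: "AE x in lebesgue. N x ** P x = mat 1"
proof -
  have "AE x in lebesgue. invertible (W x)" "\<And>x. nonneg_definite (W x)"
    using weight by (auto simp: matrix_weight_def)
  then show ?thesis by (auto elim!: eventually_mono intro: mat_powr_minus_mult)
qed

lemma reducingD:
  assumes "is_cube Q"
  shows "c * avg Q (\<lambda>x. norm (P x *v z) powr p) powr (1 / p) \<le> norm (A Q *v z)"
    and "norm (A Q *v z) \<le> C * avg Q (\<lambda>x. norm (P x *v z) powr p) powr (1 / p)"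
  using reducing[OF assms] unfolding reducing_operator_def by blast+

lemma reducing_inverse:
  assumes "is_cube Q" obtains B where "B ** A Q = mat 1" "A Q ** B = mat 1"
  using reducing[OF assms] pos_definite_invertible unfolding reducing_operator_def by metis

text \<open>Both factors are Hermitian, so the products are conjugate transposes of each other. The
  order with \<open>A Q\<close> on the left is the one to which the reducing inequality
  applies.\<close>

lemma op_norm_N_A:
  assumes "is_cube Q" shows "op_norm (N x ** A Q) = op_norm (A Q ** N x)"
proof -
  have "conj_transpose (A Q) = A Q"
    using reducing[OF assms] by (simp add: reducing_operator_def pos_definite_hermitian)
  moreover have "conj_transpose (N x) = N x"
    using weight by (intro mat_powr_hermitian) (simp add: matrix_weight_def)
  ultimately show ?thesis by (metis conj_transpose_mult op_norm_conj_transpose)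
qed

text \<open>A non-integrable function has average \<open>0\<close> here, which would contradict the positive
  definiteness of the reducing operator; measurability of \<open>W\<^sup>1\<^sup>/\<^sup>p\<close> is extracted from this, without
  functional calculus.\<close>

lemma set_integrable_P:
  assumes "is_cube Q" shows "set_integrable lebesgue Q (\<lambda>x. norm (P x *v z) powr p)"
proof (rule ccontr)
  assume not_int: "\<not> ?thesis"
  then have "avg Q (\<lambda>x. norm (P x *v z) powr p) = 0"
    by (simp add: avg_def set_lebesgue_integral_def set_integrable_def not_integrable_integral_eq)
  then have "norm (A Q *v z) \<le> 0"
    using reducingD(2)[OF assms, of z] by simp
  then have "A Q *v z = 0" by simp
  then have "z = 0"
    using reducing_inverse[OF assms] by (metis matrix_vector_mul_assoc matrix_vector_mul_lid matrix_vector_mult_0_right)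
  then show False using not_int p by (simp add: set_integrable_def)
qed

lemma norm_P_measurable [measurable]: "(\<lambda>x. norm (P x *v z)) \<in> borel_measurable lebesgue"
proof -
  let ?f = "\<lambda>x. norm (P x *v z) powr p"
  \<comment> \<open>Cubes centred at the origin that exhaust the space; \<open>Suc k\<close> keeps
    the edge positive for \<open>k = 0\<close>. Integrability on each of them gives measurability in
    the limit.\<close>
  define Q :: "nat \<Rightarrow> (real ^ 'n) set" where "Q k = half_open_cube (\<chi> i. - real (Suc k)) (2 * real (Suc k))" for k
  have "?f \<in> borel_measurable lebesgue"
  proof (rule borel_measurable_LIMSEQ_real)
    show "(\<lambda>x. indicator (Q k) x *\<^sub>R ?f x) \<in> borel_measurable lebesgue" for k
    proof -
      have "is_cube (Q k)" unfolding Q_def by (rule is_cube_half_open_cube) simp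
      from set_integrable_P[OF this] show ?thesis
        unfolding set_integrable_def by (rule borel_measurable_integrable)
    qed
    fix x :: "real ^ 'n"
    obtain k where k: "(\<Sum>i\<in>UNIV. \<bar>x $ i\<bar>) < real k" using reals_Archimedean2 by blast
    have "x \<in> Q j" if "k \<le> j" for j
    proof -
      have "\<bar>x $ i\<bar> < real (Suc j)" for i
      proof -
        have "\<bar>x $ i\<bar> \<le> (\<Sum>i\<in>UNIV. \<bar>x $ i\<bar>)" by (rule member_le_sum) auto
        then show ?thesis using k that by linarith
      qed
      then have "- real (Suc j) \<le> x $ i \<and> x $ i < - real (Suc j) + 2 * real (Suc j)" for i
        unfolding abs_less_iff by (smt (verit))
      then show ?thesis by (simp add: Q_def half_open_cube_def)
    qed
    then have "\<forall>\<^sub>F j in sequentially. indicator (Q j) x *\<^sub>R ?f x = ?f x"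
      by (intro eventually_mono[OF eventually_ge_at_top[of k]]) simp
    then show "(\<lambda>j. indicator (Q j) x *\<^sub>R ?f x) \<longlonglongrightarrow> ?f x"
      by (rule tendsto_eventually)
  qed
  then have "(\<lambda>x. ?f x powr (1 / p)) \<in> borel_measurable lebesgue" by measurable
  then show ?thesis using p by (simp add: powr_powr)
qed

lemma op_norm_P_mult_measurable [measurable]:
  "(\<lambda>x. op_norm (P x ** B)) \<in> borel_measurable lebesgue"
  by (rule op_norm_measurable) (simp flip: matrix_vector_mul_assoc)

text \<open>Off a null set \<open>N y\<close> inverts \<open>P y\<close>, and there a sublevel set
  is given by countably many conditions on \<open>P y\<close>; every subset of the null set is
  measurable.\<close>

lemma op_norm_mult_N_measurable [measurable]:
  "(\<lambda>y. op_norm (B ** N y)) \<in> borel_measurable lebesgue"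
proof -
  obtain D :: "(complex ^ 'm) set" where D: "countable D" "closure D = UNIV"
    by (rule obtain_countable_dense)
  have null: "{y. N y ** P y \<noteq> mat 1} \<in> null_sets lebesgue"
    using N_P_AE by (simp only: AE_lebesgue_null_sets)
  have "{y \<in> space lebesgue. op_norm (B ** N y) \<le> b} \<in> sets lebesgue" for b
  proof -
    let ?E = "{y \<in> space lebesgue. \<forall>z\<in>D. norm (B *v z) \<le> b * norm (P y *v z)}"
    have E: "?E \<in> sets lebesgue"
      by (intro sets.sets_Collect_countable_All' D(1)) measurable
    have "{y \<in> space lebesgue. op_norm (B ** N y) \<le> b} =
       (?E - {y. N y ** P y \<noteq> mat 1}) \<union> {y. N y ** P y \<noteq> mat 1 \<and> op_norm (B ** N y) \<le> b}"
      using op_norm_mult_inverse_le_iff[OF _ D(2)] by auto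
    moreover have "{y. N y ** P y \<noteq> mat 1 \<and> op_norm (B ** N y) \<le> b} \<in> sets lebesgue"
      by (rule null_setsD2[OF null_sets_completion_subset[OF _ null]]) auto
    ultimately show ?thesis using E null by auto
  qed
  then show ?thesis by (simp add: borel_measurable_iff_le)
qed

section \<open>Comparison of averages with the reducing operator\<close>

text \<open>The power comes from \<open>op_norm_powr_le_sum\<close>; the other factor counts the
  columns.\<close>

definition \<kappa> :: real where "\<kappa> = real CARD('m) powr p * real CARD('m)"

lemma kappa_pos: "0 < \<kappa>" by (simp add: \<kappa>_def)

lemma set_integrable_op_norm:
  assumes Q: "is_cube Q" shows "set_integrable lebesgue Q (\<lambda>x. op_norm (P x ** B) powr p)"
proof (rule set_integrable_bound_AE[OF Q])
  show "set_integrable lebesgue Q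
      (\<lambda>x. real CARD('m) powr p * (\<Sum>i\<in>UNIV. norm (P x *v (B *v axis i 1)) powr p))"
    by (intro set_integrable_mult_right set_integrable_sum set_integrable_P Q)
  show "AE x in lebesgue. x \<in> Q \<longrightarrow> \<bar>op_norm (P x ** B) powr p\<bar>
      \<le> real CARD('m) powr p * (\<Sum>i\<in>UNIV. norm (P x *v (B *v axis i 1)) powr p)"
    using op_norm_powr_le_sum[OF p, of "P _ ** B"] by (simp add: matrix_vector_mul_assoc)
qed measurable

text \<open>The reducing inequality is applied to the columns of \<open>B\<close>. A general
  \<open>B\<close> is kept because two matrices are inserted later: \<open>N y\<close>, which gives
  the inner average, and the inverse of \<open>A Q\<close>.\<close>

lemma avg_op_norm_le:
  assumes Q: "is_cube Q"
  shows "avg Q (\<lambda>x. op_norm (P x ** B) powr p) \<le> \<kappa> / c powr p * op_norm (A Q ** B) powr p"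
proof -
  have J: "avg Q (\<lambda>x. norm (P x *v (B *v axis i 1)) powr p) \<le> op_norm (A Q ** B) powr p / c powr p" for i
  proof -
    let ?J = "avg Q (\<lambda>x. norm (P x *v (B *v axis i 1)) powr p)"
    have J0: "0 \<le> ?J" by (rule avg_nonneg[OF Q]) simp
    have "c * ?J powr (1 / p) \<le> norm ((A Q ** B) *v axis i 1)"
      using reducingD(1)[OF Q, of "B *v axis i 1"] by (simp only: matrix_vector_mul_assoc)
    also have "\<dots> \<le> op_norm (A Q ** B)" by (rule norm_axis_le_op_norm)
    finally have "(c * ?J powr (1 / p)) powr p \<le> op_norm (A Q ** B) powr p"
      using c p by (intro powr_mono2) auto
    then have "c powr p * ?J \<le> op_norm (A Q ** B) powr p"
      using c p J0 by (simp add: powr_mult powr_powr)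
    then show ?thesis using c by (simp add: pos_le_divide_eq mult.commute)
  qed
  have "avg Q (\<lambda>x. op_norm (P x ** B) powr p)
      \<le> avg Q (\<lambda>x. real CARD('m) powr p * (\<Sum>i\<in>UNIV. norm (P x *v (B *v axis i 1)) powr p))"
  proof (rule avg_mono[OF Q set_integrable_op_norm[OF Q]])
    show "set_integrable lebesgue Q
        (\<lambda>x. real CARD('m) powr p * (\<Sum>i\<in>UNIV. norm (P x *v (B *v axis i 1)) powr p))"
      by (intro set_integrable_mult_right set_integrable_sum set_integrable_P Q)
  qed (use op_norm_powr_le_sum[OF p, of "P _ ** B"] in \<open>simp add: matrix_vector_mul_assoc\<close>)
  also have "\<dots> = real CARD('m) powr p * (\<Sum>i\<in>UNIV. avg Q (\<lambda>x. norm (P x *v (B *v axis i 1)) powr p))"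
    by (simp add: avg_cmult avg_sum Q set_integrable_P)
  also have "\<dots> \<le> real CARD('m) powr p * (real CARD('m) * (op_norm (A Q ** B) powr p / c powr p))"
    by (intro mult_left_mono sum_bounded_above J) auto
  finally show ?thesis by (simp add: \<kappa>_def)
qed

lemma op_norm_A_le:
  assumes Q: "is_cube Q"
  shows "op_norm (A Q ** B) powr p \<le> \<kappa> * C powr p * avg Q (\<lambda>x. op_norm (P x ** B) powr p)"
proof -
  have "norm ((A Q ** B) *v axis i 1) powr p \<le> C powr p * avg Q (\<lambda>x. op_norm (P x ** B) powr p)" for i
  proof -
    let ?J = "avg Q (\<lambda>x. norm (P x *v (B *v axis i 1)) powr p)"
    have J0: "0 \<le> ?J" by (rule avg_nonneg[OF Q]) simp
    have "norm ((A Q ** B) *v axis i 1) \<le> C * ?J powr (1 / p)"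
      using reducingD(2)[OF Q, of "B *v axis i 1"] by (simp only: matrix_vector_mul_assoc)
    then have "norm ((A Q ** B) *v axis i 1) powr p \<le> (C * ?J powr (1 / p)) powr p"
      using p by (intro powr_mono2) auto
    also have "\<dots> = C powr p * ?J" using C p J0 by (simp add: powr_mult powr_powr)
    finally have "norm ((A Q ** B) *v axis i 1) powr p \<le> C powr p * ?J" .
    moreover have "?J \<le> avg Q (\<lambda>x. op_norm (P x ** B) powr p)"
      using norm_axis_le_op_norm[of "P _ ** B" i] p
      by (intro avg_mono[OF Q] set_integrable_P set_integrable_op_norm Q powr_mono2)
         (auto simp: matrix_vector_mul_assoc)
    ultimately show ?thesis by (meson mult_left_mono order_trans powr_ge_zero)
  qed
  then have "(\<Sum>i\<in>UNIV. norm ((A Q ** B) *v axis i 1) powr p)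
      \<le> real CARD('m) * (C powr p * avg Q (\<lambda>x. op_norm (P x ** B) powr p))"
    by (intro sum_bounded_above)
  then have "real CARD('m) powr p * (\<Sum>i\<in>UNIV. norm ((A Q ** B) *v axis i 1) powr p)
      \<le> real CARD('m) powr p * (real CARD('m) * (C powr p * avg Q (\<lambda>x. op_norm (P x ** B) powr p)))"
    by (intro mult_left_mono) auto
  with op_norm_powr_le_sum[OF p, of "A Q ** B"] show ?thesis
    unfolding \<kappa>_def mult.assoc by (rule order_trans)
qed

text \<open>The average over \<open>x\<close> is measurable in \<open>y\<close> once the norm of
  \<open>P x ** N y\<close> is jointly measurable; its sublevel sets amount to countably many
  comparisons of \<open>P x\<close> with \<open>P y\<close>.\<close>

lemma inner_measurable:
  assumes Q: "is_cube Q"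
  shows "A_p_infty_inner p W Q \<in> borel_measurable lebesgue"
proof -
  interpret sigma_finite_measure "lebesgue :: (real ^ 'n) measure"
    by (rule sigma_finite_completion[OF sigma_finite_lborel])
  obtain D :: "(complex ^ 'm) set" where D: "countable D" "closure D = UNIV"
    by (rule obtain_countable_dense)
  have null: "{y. N y ** P y \<noteq> mat 1} \<in> null_sets lebesgue"
    using N_P_AE by (simp only: AE_lebesgue_null_sets)
  define Y where "Y = {y. N y ** P y = mat 1}"
  have "Y = space lebesgue - {y. N y ** P y \<noteq> mat 1}" by (auto simp: Y_def)
  then have Y [measurable]: "Y \<in> sets lebesgue" using null by (simp only: null_setsD2 sets.compl_sets)
  \<comment> \<open>Setting the kernel to 0 where \<open>N y\<close> fails to invert
    \<open>P y\<close> makes the description through \<open>D\<close> valid for every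
    \<open>y\<close>; only a null set of \<open>y\<close> is affected.\<close>
  define k where "k y x = (if y \<in> Y then op_norm (P x ** N y) else 0)" for x y
  let ?M = "lebesgue \<Otimes>\<^sub>M lebesgue :: ((real ^ 'n) \<times> (real ^ 'n)) measure"
  have k_le: "k y x \<le> b \<longleftrightarrow> 0 \<le> b \<and> (y \<in> Y \<longrightarrow> (\<forall>z\<in>D. norm (P x *v z) \<le> b * norm (P y *v z)))" for x y b
    using op_norm_mult_inverse_le_iff[OF _ D(2), of "N y" "P y" "P x" b] op_norm_nonneg[of "P x ** N y"]
    by (auto simp: k_def Y_def)
  have k_meas: "(\<lambda>(y, x). k y x) \<in> borel_measurable ?M"
    unfolding borel_measurable_iff_le
  proof
    fix b
    have 1: "{w \<in> space ?M. \<forall>z\<in>D. norm (P (snd w) *v z) \<le> b * norm (P (fst w) *v z)} \<in> sets ?M"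
      by (intro sets.sets_Collect_countable_All' D(1)) measurable
    have 2: "{w \<in> space ?M. fst w \<in> Y} \<in> sets ?M" by measurable
    have "{w \<in> space ?M. (case w of (y, x) \<Rightarrow> k y x) \<le> b} = {w \<in> space ?M. 0 \<le> b \<and>
        (fst w \<in> Y \<longrightarrow> (\<forall>z\<in>D. norm (P (snd w) *v z) \<le> b * norm (P (fst w) *v z)))}"
      by (auto simp: k_le)
    also have "\<dots> \<in> sets ?M"
      by (intro sets.sets_Collect_conj sets.sets_Collect_imp 1 2 sets.sets_Collect_const)
    finally show "{w \<in> space ?M. (case w of (y, x) \<Rightarrow> k y x) \<le> b} \<in> sets ?M" .
  qed
  note [measurable] = cube_measure(1)[OF Q]
  have "(\<lambda>(y, x). indicator Q x *\<^sub>R (k y x powr p)) \<in> borel_measurable ?M"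
    using k_meas unfolding split_beta' by measurable
  then have "(\<lambda>y. \<integral>x. indicator Q x *\<^sub>R (k y x powr p) \<partial>lebesgue) \<in> borel_measurable lebesgue"
    by (rule borel_measurable_lebesgue_integral)
  then have f: "(\<lambda>y. avg Q (\<lambda>x. k y x powr p)) \<in> borel_measurable lebesgue" (is "?f \<in> _")
    unfolding avg_def set_lebesgue_integral_def by measurable
  have eq: "A_p_infty_inner p W Q y = ?f y" if "y \<in> Y" for y
    using that by (simp add: k_def A_p_infty_inner_def)
  have "AE y in lebesgue. ?f y = A_p_infty_inner p W Q y"
    using N_P_AE by eventually_elim (simp add: Y_def eq)
  from borel_measurable_lebesgue_cong_AE[OF f this] show ?thesis .
qed

lemma inner_le:
  assumes "is_cube Q"
  shows "A_p_infty_inner p W Q y \<le> \<kappa> / c powr p * op_norm (A Q ** N y) powr p"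
  unfolding A_p_infty_inner_def by (rule avg_op_norm_le[OF assms])

lemma le_inner:
  assumes "is_cube Q"
  shows "op_norm (A Q ** N y) powr p \<le> \<kappa> * C powr p * A_p_infty_inner p W Q y"
  unfolding A_p_infty_inner_def by (rule op_norm_A_le[OF assms])

lemma inner_nonneg: "is_cube Q \<Longrightarrow> 0 \<le> A_p_infty_inner p W Q y"
  unfolding A_p_infty_inner_def by (rule avg_nonneg) auto

text \<open>The normalization of the weight by its reducing operator. It enters twice: in the
  comparison of two cubes and in the bound for the negative part of the logarithm.\<close>

lemma avg_op_norm_inverse_le:
  assumes "is_cube Q" "A Q ** B = mat 1"
  shows "avg Q (\<lambda>x. op_norm (P x ** B) powr p) \<le> \<kappa> / c powr p"
  using avg_op_norm_le[OF assms(1), of B] by (simp add: assms(2) op_norm_mat_1)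

section \<open>The logarithms on different cubes and their averages\<close>

definition G :: "(real ^ 'n) set \<Rightarrow> real ^ 'n \<Rightarrow> real" where
  "G Q x = log_plus (op_norm (A Q ** N x))"

lemma G_measurable: "G Q \<in> borel_measurable lebesgue"
  unfolding G_def[abs_def] by measurable

lemma G_nonneg: "0 \<le> G Q x" by (simp add: G_def)

text \<open>The left side is constant and may be averaged over \<open>R\<close>. Inserting
  \<open>N x ** P x\<close> splits it into \<open>G Q x\<close>, of average at most
  \<open>s\<close>, and a term in \<open>P x ** B\<close>, for which
  \<open>log_plus t \<le> t powr p / p\<close> leaves only the bounded average of a
  \<open>p\<close>-th power.\<close>

lemma log_plus_op_norm_A_inverse_le:
  assumes Q: "is_cube Q" and R: "is_cube R" and s: "0 \<le> s" "nn_avg R (G Q) \<le> ennreal s"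
    and B: "A R ** B = mat 1"
  shows "log_plus (op_norm (A Q ** B)) \<le> s + \<kappa> / c powr p / p"
proof -
  let ?L = "log_plus (op_norm (A Q ** B))"
  have int: "set_integrable lebesgue R (G Q)"
    using set_integrable_nn_avg[OF R G_measurable G_nonneg s(2)] .
  then have "avg R (G Q) \<le> s"
    using s nn_avg_eq_avg[OF R int G_nonneg] by (simp add: ennreal_le_iff)
  have int': "set_integrable lebesgue R (\<lambda>x. 1 / p * op_norm (P x ** B) powr p)"
    by (intro set_integrable_mult_right set_integrable_op_norm R)
  have "AE x in lebesgue. x \<in> R \<longrightarrow> ?L \<le> G Q x + 1 / p * op_norm (P x ** B) powr p"
    using N_P_AE
  proof eventually_elim
    case (elim x)
    have "A Q ** B = (A Q ** N x) ** (P x ** B)"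
      by (metis elim matrix_mul_assoc matrix_mul_rid)
    then have "op_norm (A Q ** B) \<le> op_norm (A Q ** N x) * op_norm (P x ** B)"
      by (metis op_norm_mult_le)
    then have "?L \<le> log_plus (op_norm (A Q ** N x) * op_norm (P x ** B))"
      by (intro log_plus_mono op_norm_nonneg)
    also have "\<dots> \<le> G Q x + log_plus (op_norm (P x ** B))"
      unfolding G_def by (intro log_plus_mult_le op_norm_nonneg)
    also have "log_plus (op_norm (P x ** B)) = 1 / p * log_plus (op_norm (P x ** B) powr p)"
      using p by (simp add: log_plus_powr op_norm_nonneg)
    also have "\<dots> \<le> 1 / p * op_norm (P x ** B) powr p"
      using p by (intro mult_left_mono log_plus_le) auto
    finally show ?case by simp
  qed
  then have "avg R (\<lambda>x. ?L) \<le> avg R (\<lambda>x. G Q x + 1 / p * op_norm (P x ** B) powr p)"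
    using int int' by (intro avg_mono_AE[OF R] set_integrable_const_cube R set_integral_add)
  also have "\<dots> = avg R (G Q) + 1 / p * avg R (\<lambda>x. op_norm (P x ** B) powr p)"
    using avg_add[OF R int int'] by (simp only: avg_cmult[OF R])
  also have "\<dots> \<le> s + 1 / p * (\<kappa> / c powr p)"
    using p by (intro add_mono mult_left_mono avg_op_norm_inverse_le R B \<open>avg R (G Q) \<le> s\<close>) auto
  finally show ?thesis by (simp add: avg_const[OF R] mult.commute)
qed

text \<open>Only the constant matrix \<open>A R\<close> is inverted here, not the weight, so the
  bound holds at every \<open>x\<close>, as \<open>John_Nirenberg\<close> demands.\<close>

lemma G_le_G:
  assumes Q: "is_cube Q" and R: "is_cube R" and s: "0 \<le> s" "nn_avg R (G Q) \<le> ennreal s"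
  shows "G Q x \<le> \<kappa> / c powr p / p + s + G R x"
proof -
  obtain B where B: "B ** A R = mat 1" "A R ** B = mat 1" using reducing_inverse[OF R] .
  have "A Q ** N x = (A Q ** B) ** (A R ** N x)"
    by (metis B(1) matrix_mul_assoc matrix_mul_rid)
  then have "op_norm (A Q ** N x) \<le> op_norm (A Q ** B) * op_norm (A R ** N x)"
    by (metis op_norm_mult_le)
  then have "G Q x \<le> log_plus (op_norm (A Q ** B) * op_norm (A R ** N x))"
    unfolding G_def by (intro log_plus_mono op_norm_nonneg)
  also have "\<dots> \<le> log_plus (op_norm (A Q ** B)) + G R x"
    unfolding G_def by (intro log_plus_mult_le op_norm_nonneg)
  finally show ?thesis using log_plus_op_norm_A_inverse_le[OF Q R s B(2)] by linarith
qed

lemma G_le_log_plus_inner: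
  assumes "is_cube Q"
  shows "G Q y \<le> (log_plus (\<kappa> * C powr p) + log_plus (A_p_infty_inner p W Q y)) / p"
proof -
  have "p * G Q y = log_plus (op_norm (A Q ** N y) powr p)"
    unfolding G_def using p by (simp add: log_plus_powr op_norm_nonneg)
  also have "\<dots> \<le> log_plus (\<kappa> * C powr p * A_p_infty_inner p W Q y)"
    by (intro log_plus_mono le_inner assms) simp
  also have "\<dots> \<le> log_plus (\<kappa> * C powr p) + log_plus (A_p_infty_inner p W Q y)"
    using kappa_pos inner_nonneg[OF assms] by (intro log_plus_mult_le) auto
  finally show ?thesis using p by (simp add: pos_le_divide_eq mult.commute)
qed

text \<open>Writing \<open>p * log_plus t\<close> as \<open>p / u * log_plus (t powr u)\<close> lets
  an arbitrarily small power control the logarithm.\<close>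

lemma log_plus_inner_le:
  assumes "is_cube Q" "0 < u"
  shows "log_plus (A_p_infty_inner p W Q y)
    \<le> log_plus (\<kappa> / c powr p) + p / u * op_norm (A Q ** N y) powr u"
proof -
  let ?t = "op_norm (A Q ** N y)"
  have "log_plus (A_p_infty_inner p W Q y) \<le> log_plus (\<kappa> / c powr p * ?t powr p)"
    by (intro log_plus_mono inner_le inner_nonneg assms)
  also have "\<dots> \<le> log_plus (\<kappa> / c powr p) + log_plus (?t powr p)"
    using kappa_pos by (intro log_plus_mult_le) auto
  also have "log_plus (?t powr p) = p / u * log_plus (?t powr u)"
    using p assms by (simp add: log_plus_powr op_norm_nonneg)
  also have "\<dots> \<le> p / u * ?t powr u"
    using p assms by (intro mult_left_mono log_plus_le) auto
  finally show ?thesis by simp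
qed

text \<open>The negative part of the logarithm is controlled through
  \<open>1 = \<parallel>A\<^sub>Q W\<^sup>-\<^sup>1\<^sup>/\<^sup>p W\<^sup>1\<^sup>/\<^sup>p A\<^sub>Q\<^sup>-\<^sup>1\<parallel>\<close>.\<close>

lemma ln_inner_ge:
  assumes Q: "is_cube Q" and B: "A Q ** B = mat 1" and y: "N y ** P y = mat 1"
  shows "- ln (A_p_infty_inner p W Q y) \<le> log_plus (\<kappa> * C powr p) + op_norm (P y ** B) powr p"
    and "0 < A_p_infty_inner p W Q y"
proof -
  let ?t = "op_norm (A Q ** N y)" and ?r = "op_norm (P y ** B)" and ?\<phi> = "A_p_infty_inner p W Q y"
  let ?k = "\<kappa> * C powr p"
  have "mat 1 = (A Q ** N y) ** (P y ** B)"
    by (metis B y matrix_mul_assoc matrix_mul_rid)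
  then have "1 \<le> ?t * ?r" by (metis op_norm_mult_le op_norm_mat_1)
  then have "?t \<noteq> 0" "?r \<noteq> 0" by auto
  then have pos: "0 < ?t" "0 < ?r" using op_norm_nonneg[of "A Q ** N y"] op_norm_nonneg[of "P y ** B"] by linarith+
  have k: "0 < ?k" using kappa_pos C by simp
  have "1 = 1 powr p" by simp
  also have "\<dots> \<le> (?t * ?r) powr p" using \<open>1 \<le> ?t * ?r\<close> p by (intro powr_mono2) auto
  also have "\<dots> = ?t powr p * ?r powr p" using pos by (simp add: powr_mult)
  also have "\<dots> \<le> ?k * ?\<phi> * ?r powr p" by (intro mult_right_mono le_inner Q) simp
  finally have one: "1 \<le> ?k * ?\<phi> * ?r powr p" .
  show \<phi>: "0 < ?\<phi>"
    using one inner_nonneg[OF Q, of y] by (cases "?\<phi> = 0") auto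
  have "0 \<le> ln (?k * ?\<phi> * ?r powr p)" using one by simp
  also have "\<dots> = ln ?k + ln ?\<phi> + ln (?r powr p)"
    using k \<phi> pos by (simp add: ln_mult_pos)
  finally have "- ln ?\<phi> \<le> ln ?k + ln (?r powr p)" by simp
  also have "\<dots> \<le> log_plus ?k + log_plus (?r powr p)" by (simp add: log_plus_def)
  also have "log_plus (?r powr p) \<le> ?r powr p" by (intro log_plus_le) simp
  finally show "- ln ?\<phi> \<le> log_plus ?k + ?r powr p" by simp
qed

lemma nn_avg_G_le:
  assumes Q: "is_cube Q"
    and int: "set_integrable lebesgue Q (\<lambda>y. log_plus (A_p_infty_inner p W Q y))"
    and le: "avg Q (\<lambda>y. ln (A_p_infty_inner p W Q y)) \<le> b"
  shows "nn_avg Q (G Q) \<le> ennreal ((2 * log_plus (\<kappa> * C powr p) + \<kappa> / c powr p + b) / p)"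
proof -
  let ?\<phi> = "A_p_infty_inner p W Q" and ?k = "log_plus (\<kappa> * C powr p)"
  obtain B where B: "A Q ** B = mat 1" using reducing_inverse[OF Q] .
  note [measurable] = inner_measurable[OF Q]
  \<comment> \<open>The negative part of the logarithm. It is dominated almost everywhere by an
    integrable function of bounded average, so it can be subtracted under the average, and a bound
    for the average of \<open>ln\<close> becomes one for that of \<open>log_plus\<close>.\<close>
  define h where "h y = log_plus (?\<phi> y) - ln (?\<phi> y)" for y
  have int_r: "set_integrable lebesgue Q (\<lambda>y. ?k + op_norm (P y ** B) powr p)"
    by (intro set_integral_add set_integrable_const_cube set_integrable_op_norm Q)
  have h: "AE y in lebesgue. 0 \<le> h y \<and> h y \<le> ?k + op_norm (P y ** B) powr p"
    using N_P_AE
  proof eventually_elim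
    case (elim y)
    have "0 \<le> ?k + op_norm (P y ** B) powr p" by simp
    then show ?case using ln_inner_ge[OF Q B elim] unfolding h_def log_plus_def by linarith
  qed
  have int_h: "set_integrable lebesgue Q h"
  proof (rule set_integrable_bound_AE[OF Q int_r])
    show "h \<in> borel_measurable lebesgue" unfolding h_def by measurable
    show "AE y in lebesgue. y \<in> Q \<longrightarrow> \<bar>h y\<bar> \<le> ?k + op_norm (P y ** B) powr p"
      using h by eventually_elim auto
  qed
  have "avg Q h \<le> avg Q (\<lambda>y. ?k + op_norm (P y ** B) powr p)"
    by (rule avg_mono_AE[OF Q int_h int_r]) (use h in eventually_elim, auto)
  also have "\<dots> = ?k + avg Q (\<lambda>y. op_norm (P y ** B) powr p)"
    by (simp add: avg_add avg_const Q set_integrable_const_cube set_integrable_op_norm)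
  also have "\<dots> \<le> ?k + \<kappa> / c powr p" using avg_op_norm_inverse_le[OF Q B] by simp
  finally have avg_h: "avg Q h \<le> ?k + \<kappa> / c powr p" .
  have "avg Q (\<lambda>y. log_plus (?\<phi> y) - h y) = avg Q (\<lambda>y. log_plus (?\<phi> y)) - avg Q h"
    by (rule avg_diff[OF Q int int_h])
  then have avg_log: "avg Q (\<lambda>y. log_plus (?\<phi> y)) \<le> ?k + \<kappa> / c powr p + b"
    using le avg_h by (simp add: h_def)
  have int_b: "set_integrable lebesgue Q (\<lambda>y. (?k + log_plus (?\<phi> y)) / p)"
    by (intro set_integrable_divide set_integral_add set_integrable_const_cube Q int)
  have int_G: "set_integrable lebesgue Q (G Q)"
    by (rule set_integrable_bound_AE[OF Q int_b G_measurable])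
       (use G_le_log_plus_inner[OF Q] G_nonneg in \<open>auto simp: abs_of_nonneg\<close>)
  have "avg Q (G Q) \<le> avg Q (\<lambda>y. (?k + log_plus (?\<phi> y)) / p)"
    by (rule avg_mono[OF Q int_G int_b G_le_log_plus_inner[OF Q]])
  also have "\<dots> = (?k + avg Q (\<lambda>y. log_plus (?\<phi> y))) / p"
    using avg_cmult[OF Q, of "1 / p"] avg_add[OF Q set_integrable_const_cube[OF Q] int, of ?k]
    by (simp add: avg_const[OF Q])
  also have "\<dots> \<le> (2 * ?k + \<kappa> / c powr p + b) / p"
    using avg_log p by (intro divide_right_mono) auto
  finally show ?thesis
    unfolding nn_avg_eq_avg[OF Q int_G G_nonneg] by (rule ennreal_leI)
qed

section \<open>The two implications\<close>

lemma A_p_infty_imp_bound: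
  assumes "W \<in> A_p_infty p"
  shows "\<exists>u>0. (SUP Q\<in>{Q. is_cube Q}. nn_avg Q (\<lambda>x. op_norm (N x ** A Q) powr u)) < \<infinity>"
proof -
  obtain e where e: "A_p_infty_const p W = ennreal e" "0 \<le> e"
    using assms by (cases "A_p_infty_const p W") (auto simp: A_p_infty_def)
  \<comment> \<open>The \<open>max 1\<close> makes the logarithm nonnegative, which keeps
    \<open>b\<close> below positive.\<close>
  have avg_le: "avg Q (\<lambda>y. ln (A_p_infty_inner p W Q y)) \<le> ln (max 1 e)" if "is_cube Q" for Q
  proof -
    have "ennreal (exp (avg Q (\<lambda>y. ln (A_p_infty_inner p W Q y)))) \<le> ennreal e"
      unfolding e(1)[symmetric] A_p_infty_const_def using that by (intro SUP_upper) simp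
    then have "exp (avg Q (\<lambda>y. ln (A_p_infty_inner p W Q y))) \<le> max 1 e"
      using e(2) by (simp add: ennreal_le_iff)
    then show ?thesis by (simp add: ln_ge_iff)
  qed
  define b where "b = (2 * log_plus (\<kappa> * C powr p) + \<kappa> / c powr p + ln (max 1 e)) / p"
  have b: "0 < b"
    unfolding b_def using kappa_pos c p by (intro divide_pos_pos add_pos_nonneg add_nonneg_pos) auto
  have G_avg: "nn_avg Q (G Q) \<le> ennreal b" if "is_cube Q" for Q
    unfolding b_def
    by (rule nn_avg_G_le[OF that _ avg_le[OF that]]) (use assms that in \<open>auto simp: A_p_infty_def\<close>)
  obtain u M where u: "0 < u" "\<And>Q. is_cube Q \<Longrightarrow> nn_avg Q (\<lambda>x. exp (u * G Q x)) \<le> ennreal M"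
    using John_Nirenberg[of G b "\<kappa> / c powr p / p"] G_measurable G_avg G_le_G b kappa_pos c p
    by (metis divide_nonneg_nonneg less_imp_le powr_ge_zero)
  have "nn_avg Q (\<lambda>x. op_norm (N x ** A Q) powr u) \<le> ennreal M" if "is_cube Q" for Q
  proof -
    have "nn_avg Q (\<lambda>x. op_norm (N x ** A Q) powr u) \<le> nn_avg Q (\<lambda>x. exp (u * G Q x))"
      unfolding G_def op_norm_N_A[OF that] using u(1)
      by (intro nn_avg_mono powr_le_exp_log_plus op_norm_nonneg) simp
    then show ?thesis using u(2)[OF that] by (rule order_trans)
  qed
  then have "(SUP Q\<in>{Q. is_cube Q}. nn_avg Q (\<lambda>x. op_norm (N x ** A Q) powr u)) \<le> ennreal M"
    by (auto intro: SUP_least)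
  then show ?thesis using u(1) by (auto intro!: exI[of _ u] intro: le_less_trans)
qed

lemma bound_imp_A_p_infty:
  assumes u: "0 < u"
    and fin: "(SUP Q\<in>{Q. is_cube Q}. nn_avg Q (\<lambda>x. op_norm (N x ** A Q) powr u)) < \<infinity>"
  shows "W \<in> A_p_infty p"
proof -
  obtain M where M: "(SUP Q\<in>{Q. is_cube Q}. nn_avg Q (\<lambda>x. op_norm (N x ** A Q) powr u)) = ennreal M" "0 \<le> M"
    using fin by (cases "SUP Q\<in>{Q. is_cube Q}. nn_avg Q (\<lambda>x. op_norm (N x ** A Q) powr u)") auto
  let ?b = "log_plus (\<kappa> / c powr p) + p / u * M"
  have main: "set_integrable lebesgue Q (\<lambda>y. log_plus (A_p_infty_inner p W Q y))"
      "avg Q (\<lambda>y. log_plus (A_p_infty_inner p W Q y)) \<le> ?b" if Q: "is_cube Q" for Q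
  proof -
    let ?f = "\<lambda>x. op_norm (A Q ** N x) powr u"
    note [measurable] = inner_measurable[OF Q]
    have le_M: "nn_avg Q ?f \<le> ennreal M"
      unfolding M(1)[symmetric] op_norm_N_A[OF Q, symmetric] using Q by (intro SUP_upper2[of Q]) auto
    have int: "set_integrable lebesgue Q ?f"
    proof (rule set_integrable_nn_avg[OF Q _ _ le_M])
      show "?f \<in> borel_measurable lebesgue" by measurable
    qed simp
    then have avg_f: "avg Q ?f \<le> M"
      using le_M M(2) nn_avg_eq_avg[OF Q int] by (simp add: ennreal_le_iff)
    have int_b: "set_integrable lebesgue Q (\<lambda>y. log_plus (\<kappa> / c powr p) + p / u * ?f y)"
      by (intro set_integral_add set_integrable_const_cube Q set_integrable_mult_right int)
    show int_l: "set_integrable lebesgue Q (\<lambda>y. log_plus (A_p_infty_inner p W Q y))"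
      by (rule set_integrable_bound_AE[OF Q int_b])
         (measurable, use log_plus_inner_le[OF Q u] in auto)
    have "avg Q (\<lambda>y. log_plus (A_p_infty_inner p W Q y)) \<le> avg Q (\<lambda>y. log_plus (\<kappa> / c powr p) + p / u * ?f y)"
      by (rule avg_mono[OF Q int_l int_b log_plus_inner_le[OF Q u]])
    also have "\<dots> = log_plus (\<kappa> / c powr p) + p / u * avg Q ?f"
      using avg_add[OF Q set_integrable_const_cube[OF Q] set_integrable_mult_right[OF int]]
      by (simp only: avg_cmult[OF Q] avg_const[OF Q])
    also have "\<dots> \<le> ?b" using avg_f p u by (intro add_left_mono mult_left_mono) auto
    finally show "avg Q (\<lambda>y. log_plus (A_p_infty_inner p W Q y)) \<le> ?b" .
  qed
  have "avg Q (\<lambda>y. ln (A_p_infty_inner p W Q y)) \<le> ?b" if Q: "is_cube Q" for Q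
  proof (cases "set_integrable lebesgue Q (\<lambda>y. ln (A_p_infty_inner p W Q y))")
    case True
    have "avg Q (\<lambda>y. ln (A_p_infty_inner p W Q y)) \<le> avg Q (\<lambda>y. log_plus (A_p_infty_inner p W Q y))"
      by (rule avg_mono[OF Q True main(1)[OF Q]]) (simp add: log_plus_def)
    then show ?thesis using main(2)[OF Q] by linarith
  next
    \<comment> \<open>The integral then has the default value 0, which is harmless because
      \<open>?b\<close> is nonnegative; integrability of the logarithm itself is thus left
      open.\<close>
    case False
    then have "avg Q (\<lambda>y. ln (A_p_infty_inner p W Q y)) = 0"
      by (simp add: avg_def set_lebesgue_integral_def set_integrable_def not_integrable_integral_eq)
    then show ?thesis using p u M(2) by simp
  qed
  then have "A_p_infty_const p W \<le> ennreal (exp ?b)"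
    unfolding A_p_infty_const_def by (intro SUP_least ennreal_leI) simp
  then have "A_p_infty_const p W < \<infinity>" by (rule le_less_trans) simp
  then show ?thesis using weight main(1) by (simp add: A_p_infty_def)
qed

end

theorem proposition4p1:
  fixes p c C :: real
    and W :: "real ^ 'n \<Rightarrow> complex ^ 'm ^ 'm"
    and A :: "(real ^ 'n) set \<Rightarrow> complex ^ 'm ^ 'm"
  assumes "0 < p" and "0 < c" and "0 < C"
    and "matrix_weight W"
    and "\<And>Q. is_cube Q \<Longrightarrow> reducing_operator c C p W Q (A Q)"
  shows "W \<in> A_p_infty p \<longleftrightarrow>
    (\<exists>u::real. 0 < u \<and>
      (SUP Q\<in>{Q. is_cube Q}.
         nn_avg Q (\<lambda>x. op_norm (mat_powr (W x) (- (1 / p)) ** A Q) powr u)) < \<infinity>)"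
proof -
  interpret reducing_operators p c C W A
    using assms by unfold_locales
  show ?thesis using A_p_infty_imp_bound bound_imp_A_p_infty by blast
qed

end
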